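(* Let $G$ be a hyperbolic group and $\varphi\in\mathrm{End}(G)$. Then the FT-BRP holds for $(\varphi,\mathrm{Geo}_A(G),\mathrm{Geo}_A(G))$ if and only if the hyperbolic BRP holds for $\varphi$.
   Context: Maps are written on the right. $A$ is a finite alphabet with a surjective (monoid) homomorphism $\pi:A^*\to G$, with $A\pi$ closed under inverses; $d_A$ is the geodesic (word) metric on the Cayley graph $\Gamma_A(G)$ of $G$ with respect to $A\pi$. $\mathrm{Geo}_A(G)=\{w\in A^*\mid |w|=d_A(1,w\pi)\}$ is the set of all geodesic words (an automatic structure for $\pi$). For a word $u$, $u^{[n]}$ is its prefix with $n$ letters, and $u^{[n]}=u$ if $n>|u|$. Words $u,v\in A^*$ $p$-fellow travel in $\Gamma_A(G)$ if $d_A(u^{[n]}\pi,v^{[n]}\pi)\le p$ for all $n\in\mathbb N$; they are $p$-MFT (meeting fellow travellers) if moreover $u\pi=v\pi$. FT-BRP: with automatic structures $L_1\subseteq A^*$ for $\pi_1:A^*\to G$ and $L_2\subseteq B^*$ for $\pi_2:B^*\to G$, the FT-BRP (fellow traveller bounded reduction property) holds for $(\varphi,L_1,L_2)$ if for every $p\ge 0$ there is $q\ge0$ such that: whenever $u_i\in L_1$ and $u_i'\in L_2$ with $u_i'\pi_2=u_i\pi_1\varphi$ for $i=1,2,3$, if $u_1u_2$ and $u_3$ are $p$-MFT in $\Gamma_A(G)$, then $u_1'u_2'$ and $u_3'$ are $q$-MFT in $\Gamma_B(G)$. Here $L_1=L_2=\mathrm{Geo}_A(G)$ and $\pi_1=\pi_2=\pi$.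 Hyperbolic BRP: with Gromov product $(g|h)=\frac12(d_A(1,g)+d_A(1,h)-d_A(g,h))$, the hyperbolic BRP holds for $\varphi$ if one (equivalently, each, by a known theorem on hyperbolic groups) of the following conditions holds: (a) there is $N\in\mathbb N$ such that for all $x,y\in G$ and every geodesic $\alpha=[x,y]$, $\alpha\varphi$ (the image of the vertices of $\alpha$) is at Hausdorff distance at most $N$ from every geodesic $[x\varphi,y\varphi]$; (b) there is $N\in\mathbb N$ such that for all $x,y\in G$ and every geodesic $\alpha=[x,y]$, $\alpha\varphi$ is contained in the $N$-neighbourhood of every geodesic $[x\varphi,y\varphi]$; (c) for every $p>0$ there is $q>0$ such that for all $u,v\in G$, $(u|v)\le p$ implies $(u\varphi|v\varphi)\le q$; (d) there is $q>0$ such that for all $u,v\in G$, $(u|v)=0$ implies $(u\varphi|v\varphi)\le q$. *)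

theory Defs
  imports Complex_Main "HOL-Algebra.Generated_Groups"
begin

text \<open>
  Functions are written on the left here, so that the element denoted by \<open>w\<pi>\<close> in right-action
  notation is \<open>\<pi> w\<close>.
\<close>

section \<open>Cayley graphs and hyperbolic groups\<close>

definition symmetric_generating_set :: "('g, 'm) monoid_scheme \<Rightarrow> 'g set \<Rightarrow> bool" where
  "symmetric_generating_set G S \<longleftrightarrow>
     S \<subseteq> carrier G \<and> (\<forall>s\<in>S. inv\<^bsub>G\<^esub> s \<in> S) \<and> generate G S = carrier G"

definition cayley_adj :: "('g, 'm) monoid_scheme \<Rightarrow> 'g set \<Rightarrow> 'g \<Rightarrow> 'g \<Rightarrow> bool" where
  "cayley_adj G S g h \<longleftrightarrow> (\<exists>s\<in>S. h = g \<otimes>\<^bsub>G\<^esub> s)"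

text \<open>
  Paths are given by their nonempty lists of vertices. No geometric realization of the Cayley graph
  is used: every point of an edge is within \<open>1/2\<close> of a vertex, which only affects constants that
  are existentially quantified below.
\<close>

definition cayley_path :: "('g, 'm) monoid_scheme \<Rightarrow> 'g set \<Rightarrow> 'g \<Rightarrow> 'g list \<Rightarrow> 'g \<Rightarrow> bool" where
  "cayley_path G S x \<alpha> y \<longleftrightarrow>
     \<alpha> \<noteq> [] \<and> hd \<alpha> = x \<and> last \<alpha> = y \<and> set \<alpha> \<subseteq> carrier G \<and> successively (cayley_adj G S) \<alpha>"

text \<open>The number of edges of a path is one less than its number of vertices.\<close>

definition cayley_dist :: "('g, 'm) monoid_scheme \<Rightarrow> 'g set \<Rightarrow> 'g \<Rightarrow> 'g \<Rightarrow> nat" where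
  "cayley_dist G S x y = (LEAST n. \<exists>\<alpha>. cayley_path G S x \<alpha> y \<and> length \<alpha> = Suc n)"

definition cayley_geodesic :: "('g, 'm) monoid_scheme \<Rightarrow> 'g set \<Rightarrow> 'g \<Rightarrow> 'g list \<Rightarrow> 'g \<Rightarrow> bool" where
  "cayley_geodesic G S x \<alpha> y \<longleftrightarrow>
     cayley_path G S x \<alpha> y \<and> length \<alpha> = Suc (cayley_dist G S x y)"

definition cayley_nbhd :: "('g, 'm) monoid_scheme \<Rightarrow> 'g set \<Rightarrow> real \<Rightarrow> 'g set \<Rightarrow> 'g set" where
  "cayley_nbhd G S r X = {g \<in> carrier G. \<exists>x\<in>X. real (cayley_dist G S g x) \<le> r}"

text \<open>Meaningful for nonempty finite \<open>X\<close> and \<open>Y\<close>, where the infimum is over a nonempty set.\<close>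

definition hausdorff_distance :: "('g, 'm) monoid_scheme \<Rightarrow> 'g set \<Rightarrow> 'g set \<Rightarrow> 'g set \<Rightarrow> real" where
  "hausdorff_distance G S X Y =
     Inf {r. 0 \<le> r \<and> X \<subseteq> cayley_nbhd G S r Y \<and> Y \<subseteq> cayley_nbhd G S r X}"

text \<open>
  Geodesic triangles are \<open>\<delta>\<close>-thin; the conditions on the other two sides follow by cyclically
  permuting the corners.
\<close>

definition hyperbolic_cayley_graph :: "('g, 'm) monoid_scheme \<Rightarrow> 'g set \<Rightarrow> real \<Rightarrow> bool" where
  "hyperbolic_cayley_graph G S \<delta> \<longleftrightarrow>
     (\<forall>x\<in>carrier G. \<forall>y\<in>carrier G. \<forall>z\<in>carrier G. \<forall>\<alpha> \<beta> \<gamma>.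
        cayley_geodesic G S x \<alpha> y \<and> cayley_geodesic G S y \<beta> z \<and> cayley_geodesic G S z \<gamma> x
        \<longrightarrow> set \<alpha> \<subseteq> cayley_nbhd G S \<delta> (set \<beta> \<union> set \<gamma>))"

definition hyperbolic_group :: "('g, 'm) monoid_scheme \<Rightarrow> bool" where
  "hyperbolic_group G \<longleftrightarrow>
     group G \<and> (\<exists>S \<delta>. finite S \<and> symmetric_generating_set G S \<and> 0 \<le> \<delta> \<and> hyperbolic_cayley_graph G S \<delta>)"

definition gromov_product :: "('g, 'm) monoid_scheme \<Rightarrow> 'g set \<Rightarrow> 'g \<Rightarrow> 'g \<Rightarrow> real" where
  "gromov_product G S g h =
     (real (cayley_dist G S \<one>\<^bsub>G\<^esub> g) + real (cayley_dist G S \<one>\<^bsub>G\<^esub> h) - real (cayley_dist G S g h)) / 2"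

section \<open>Words over an alphabet\<close>

definition word_monoid :: "'a set \<Rightarrow> 'a list monoid" where
  "word_monoid A = \<lparr>carrier = lists A, mult = (@), one = []\<rparr>"

definition letter_image :: "'a set \<Rightarrow> ('a list \<Rightarrow> 'g) \<Rightarrow> 'g set" where
  "letter_image A \<pi> = (\<lambda>a. \<pi> [a]) ` A"

text \<open>
  When \<open>G\<close> is a group, membership in \<open>hom\<close> also forces \<open>\<pi> [] = \<one>\<close>, as \<open>\<pi> []\<close> is idempotent.
\<close>

definition alphabet_for :: "('g, 'm) monoid_scheme \<Rightarrow> 'a set \<Rightarrow> ('a list \<Rightarrow> 'g) \<Rightarrow> bool" where
  "alphabet_for G A \<pi> \<longleftrightarrow>
     finite A \<and> \<pi> \<in> hom (word_monoid A) G \<and> \<pi> ` lists A = carrier G \<and>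
     (\<forall>s\<in>letter_image A \<pi>. inv\<^bsub>G\<^esub> s \<in> letter_image A \<pi>)"

definition word_dist :: "('g, 'm) monoid_scheme \<Rightarrow> 'a set \<Rightarrow> ('a list \<Rightarrow> 'g) \<Rightarrow> 'g \<Rightarrow> 'g \<Rightarrow> nat" where
  "word_dist G A \<pi> = cayley_dist G (letter_image A \<pi>)"

definition Geo :: "('g, 'm) monoid_scheme \<Rightarrow> 'a set \<Rightarrow> ('a list \<Rightarrow> 'g) \<Rightarrow> 'a list set" where
  "Geo G A \<pi> = {w \<in> lists A. length w = word_dist G A \<pi> \<one>\<^bsub>G\<^esub> (\<pi> w)}"

section \<open>Bounded reduction properties\<close>

definition fellow_travel ::
  "('g, 'm) monoid_scheme \<Rightarrow> 'a set \<Rightarrow> ('a list \<Rightarrow> 'g) \<Rightarrow> real \<Rightarrow> 'a list \<Rightarrow> 'a list \<Rightarrow> bool" where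
  "fellow_travel G A \<pi> p u v \<longleftrightarrow>
     (\<forall>n. real (word_dist G A \<pi> (\<pi> (take n u)) (\<pi> (take n v))) \<le> p)"

definition meeting_fellow_travel ::
  "('g, 'm) monoid_scheme \<Rightarrow> 'a set \<Rightarrow> ('a list \<Rightarrow> 'g) \<Rightarrow> real \<Rightarrow> 'a list \<Rightarrow> 'a list \<Rightarrow> bool" where
  "meeting_fellow_travel G A \<pi> p u v \<longleftrightarrow> fellow_travel G A \<pi> p u v \<and> \<pi> u = \<pi> v"

definition FT_BRP ::
  "('g, 'm) monoid_scheme \<Rightarrow> ('g \<Rightarrow> 'g) \<Rightarrow>
   'a set \<Rightarrow> ('a list \<Rightarrow> 'g) \<Rightarrow> 'a list set \<Rightarrow> 'b set \<Rightarrow> ('b list \<Rightarrow> 'g) \<Rightarrow> 'b list set \<Rightarrow> bool" where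
  "FT_BRP G \<phi> A \<pi>1 L1 B \<pi>2 L2 \<longleftrightarrow>
     (\<forall>p\<ge>0. \<exists>q\<ge>0. \<forall>u1\<in>L1. \<forall>u2\<in>L1. \<forall>u3\<in>L1. \<forall>v1\<in>L2. \<forall>v2\<in>L2. \<forall>v3\<in>L2.
        \<pi>2 v1 = \<phi> (\<pi>1 u1) \<and> \<pi>2 v2 = \<phi> (\<pi>1 u2) \<and> \<pi>2 v3 = \<phi> (\<pi>1 u3) \<longrightarrow>
        meeting_fellow_travel G A \<pi>1 p (u1 @ u2) u3 \<longrightarrow>
        meeting_fellow_travel G B \<pi>2 q (v1 @ v2) v3)"

definition hyp_BRP_hausdorff :: "('g, 'm) monoid_scheme \<Rightarrow> 'g set \<Rightarrow> ('g \<Rightarrow> 'g) \<Rightarrow> bool" where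
  "hyp_BRP_hausdorff G S \<phi> \<longleftrightarrow>
     (\<exists>N::nat. \<forall>x\<in>carrier G. \<forall>y\<in>carrier G. \<forall>\<alpha> \<beta>.
        cayley_geodesic G S x \<alpha> y \<and> cayley_geodesic G S (\<phi> x) \<beta> (\<phi> y) \<longrightarrow>
        hausdorff_distance G S (\<phi> ` set \<alpha>) (set \<beta>) \<le> real N)"

definition hyp_BRP_nbhd :: "('g, 'm) monoid_scheme \<Rightarrow> 'g set \<Rightarrow> ('g \<Rightarrow> 'g) \<Rightarrow> bool" where
  "hyp_BRP_nbhd G S \<phi> \<longleftrightarrow>
     (\<exists>N::nat. \<forall>x\<in>carrier G. \<forall>y\<in>carrier G. \<forall>\<alpha> \<beta>.
        cayley_geodesic G S x \<alpha> y \<and> cayley_geodesic G S (\<phi> x) \<beta> (\<phi> y) \<longrightarrow>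
        \<phi> ` set \<alpha> \<subseteq> cayley_nbhd G S (real N) (set \<beta>))"

definition hyp_BRP_product :: "('g, 'm) monoid_scheme \<Rightarrow> 'g set \<Rightarrow> ('g \<Rightarrow> 'g) \<Rightarrow> bool" where
  "hyp_BRP_product G S \<phi> \<longleftrightarrow>
     (\<forall>p>0. \<exists>q>0. \<forall>u\<in>carrier G. \<forall>v\<in>carrier G.
        gromov_product G S u v \<le> p \<longrightarrow> gromov_product G S (\<phi> u) (\<phi> v) \<le> q)"

definition hyp_BRP_product_zero :: "('g, 'm) monoid_scheme \<Rightarrow> 'g set \<Rightarrow> ('g \<Rightarrow> 'g) \<Rightarrow> bool" where
  "hyp_BRP_product_zero G S \<phi> \<longleftrightarrow>
     (\<exists>q>0. \<forall>u\<in>carrier G. \<forall>v\<in>carrier G.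
        gromov_product G S u v = 0 \<longrightarrow> gromov_product G S (\<phi> u) (\<phi> v) \<le> q)"

text \<open>
  The property is that one of four conditions holds. For endomorphisms of hyperbolic groups these
  are known to be equivalent; the definition does not presuppose this.
\<close>

definition hyperbolic_BRP :: "('g, 'm) monoid_scheme \<Rightarrow> 'g set \<Rightarrow> ('g \<Rightarrow> 'g) \<Rightarrow> bool" where
  "hyperbolic_BRP G S \<phi> \<longleftrightarrow>
     hyp_BRP_hausdorff G S \<phi> \<or> hyp_BRP_nbhd G S \<phi> \<or>
     hyp_BRP_product G S \<phi> \<or> hyp_BRP_product_zero G S \<phi>"

end

theory Submission
  imports Defs
begin

text \<open>
  Both properties are equivalent to a third one: if \<open>p\<close> lies on a geodesic from \<open>x\<close> to \<open>y\<close>, then going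
  from \<open>\<phi> x\<close> to \<open>\<phi> y\<close> through \<open>\<phi> p\<close> is longer than going directly by at most a constant
  (\<open>coarsely_preserves_geodesics\<close>).

  Each of the four forms of the hyperbolic BRP is related to this property by the triangle inequality
  and left invariance of the word metric alone (\<open>hyperbolic_BRP_iff_coarse\<close>): the Hausdorff form
  implies the neighbourhood form, which bounds detours, and the form with vanishing Gromov products is
  the property itself after translating \<open>p\<close> to the identity; it is contained in the form with bounded
  products.

  The FT-BRP yields the property by applying it to a geodesic word that is cut into two pieces
  (\<open>FT_BRP_imp_coarse\<close>). Conversely, the property and the Lipschitz continuity of \<open>\<phi>\<close> bound the
  detour that the first two image words make, and in a hyperbolic space the two sides of a triangle
  with bounded detour synchronously fellow travel with the third side
  (\<open>short_detour_fellow_travels\<close>, \<open>coarse_imp_FT_BRP\<close>).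

  The last step needs thin triangles in the Cayley graph of the given alphabet, whereas
  hyperbolicity of the group provides them for some finite generating set. The invariance of
  hyperbolicity follows from the stability of quasi-geodesics
  (\<open>geodesic_near_quasi_geodesic\<close>, \<open>quasi_geodesic_near_geodesic\<close>), which is proved for
  discrete metric spaces in which any two points are joined by a geodesic. There everything is
  expressed through the relation \<open>d x p + d p y = d x y\<close>, so that no paths have to be manipulated.
\<close>

section \<open>Discrete geodesic metric spaces and thin triangles\<close>

definition between :: "('a \<Rightarrow> 'a \<Rightarrow> nat) \<Rightarrow> 'a \<Rightarrow> 'a \<Rightarrow> 'a \<Rightarrow> bool" where
  "between d x p y \<longleftrightarrow> d x p + d p y = d x y"

text \<open>
  The points \<open>w\<close> with \<open>d x w + d w z = d x z\<close> are the points on some geodesic from \<open>x\<close> to \<open>z\<close>, so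
  this is the slim triangle condition with the choice of the sides quantified away. It constrains
  degenerate triangles as well, which makes geodesics with common endpoints close to each other.
\<close>

definition thin_triangles :: "'a set \<Rightarrow> ('a \<Rightarrow> 'a \<Rightarrow> nat) \<Rightarrow> nat \<Rightarrow> bool" where
  "thin_triangles X d \<delta> \<longleftrightarrow>
     (\<forall>x\<in>X. \<forall>y\<in>X. \<forall>z\<in>X. \<forall>p\<in>X. between d x p y \<longrightarrow>
        (\<exists>w\<in>X. d p w \<le> \<delta> \<and> (between d x w z \<or> between d z w y)))"

definition geodesic_seq :: "'a set \<Rightarrow> ('a \<Rightarrow> 'a \<Rightarrow> nat) \<Rightarrow> (nat \<Rightarrow> 'a) \<Rightarrow> nat \<Rightarrow> bool" where
  "geodesic_seq X d f n \<longleftrightarrow>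
     (\<forall>i\<le>n. f i \<in> X) \<and> (\<forall>i j. i \<le> j \<longrightarrow> j \<le> n \<longrightarrow> d (f i) (f j) = j - i)"

text \<open>
  With \<open>l\<close> and \<open>m\<close> as the comparison constants of two metrics, this is what a geodesic of one of
  them becomes for the other.
\<close>

definition quasi_geodesic_seq ::
  "'a set \<Rightarrow> ('a \<Rightarrow> 'a \<Rightarrow> nat) \<Rightarrow> nat \<Rightarrow> nat \<Rightarrow> (nat \<Rightarrow> 'a) \<Rightarrow> nat \<Rightarrow> bool" where
  "quasi_geodesic_seq X d l m f n \<longleftrightarrow>
     (\<forall>i\<le>n. f i \<in> X) \<and>
     (\<forall>i j. i \<le> j \<longrightarrow> j \<le> n \<longrightarrow> d (f i) (f j) \<le> l * (j - i) \<and> j - i \<le> m * d (f i) (f j))"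

lemma linear_below_exponential:
  fixes a b :: nat
  shows "\<exists>K. \<forall>k\<ge>K. a * k + b < 2 ^ k"
proof (intro exI allI impI)
  fix k assume k: "a + b + 4 \<le> k"
  \<comment> \<open>From \<open>k = 4\<close> on, the exponential dominates the square.\<close>
  have sq: "k * k \<le> 2 ^ k" if "4 \<le> k" for k :: nat
    using that
  proof (induction k rule: dec_induct)
    case (step k)
    have "2 * k + 1 \<le> k * k"
      using mult_le_mono1[OF step.hyps(1), of k] step.hyps(1) by linarith
    then show ?case using step.IH by simp
  qed simp
  have "a * k + b < (a + b + 4) * k" using k by (cases k) (auto simp: algebra_simps)
  also have "\<dots> \<le> k * k" using k by (rule mult_le_mono1)
  also have "\<dots> \<le> 2 ^ k" using sq k by simp
  finally show "a * k + b < 2 ^ k" .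
qed

text \<open>
  The hypothesis amounts to \<open>D \<le> \<delta> log\<^sub>2 (c D) + l\<close>, with the logarithm rounded up, and \<open>D\<close> grows
  faster than its logarithm. For large \<open>D\<close> the least admissible \<open>k\<close> contradicts the comparison of
  linear and exponential growth, as \<open>2 ^ k < 2 c D\<close>.
\<close>

lemma logarithmic_bound_imp_bounded:
  fixes c \<delta> l :: nat
  shows "\<exists>B. \<forall>D. (\<forall>k. c * D \<le> 2 ^ k \<longrightarrow> D \<le> k * \<delta> + l) \<longrightarrow> D \<le> B"
proof -
  obtain K where K: "\<And>k. k \<ge> K \<Longrightarrow> (2 * c * \<delta>) * k + 2 * c * l < 2 ^ k"
    using linear_below_exponential by metis
  have "D \<le> K * \<delta> + l" if D: "\<And>k. c * D \<le> 2 ^ k \<Longrightarrow> D \<le> k * \<delta> + l" for D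
  proof (rule ccontr)
    assume big: "\<not> ?thesis"
    define k where "k = (LEAST k. c * D \<le> 2 ^ k)"
    have ex: "c * D \<le> 2 ^ (c * D)" by (simp add: less_imp_le)
    have k: "c * D \<le> 2 ^ k" unfolding k_def using ex by (rule LeastI)
    have "D \<le> k * \<delta> + l" using D k by simp
    with big have "K < k" by (meson add_le_mono1 le_trans mult_le_mono1 not_le_imp_less)
    then obtain k' where k': "k = Suc k'" "K \<le> k'" by (cases k) auto
    have "\<not> c * D \<le> 2 ^ k'" using not_less_Least[of k' "\<lambda>k. c * D \<le> 2 ^ k"] k'(1) unfolding k_def by simp
    then have "2 ^ k \<le> 2 * (c * D)" using k' by simp
    also have "\<dots> \<le> 2 * (c * (k * \<delta> + l))" using \<open>D \<le> k * \<delta> + l\<close> by (simp only: mult_le_mono2)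
    also have "\<dots> < 2 ^ k" using K[of k] \<open>K < k\<close> by (simp add: algebra_simps)
    finally show False by simp
  qed
  then show ?thesis by blast
qed

lemma thin_trianglesE:
  assumes "thin_triangles X d \<delta>" "x \<in> X" "y \<in> X" "z \<in> X" "p \<in> X" "between d x p y"
  obtains w where "w \<in> X" "d p w \<le> \<delta>" "between d x w z \<or> between d z w y"
  using assms unfolding thin_triangles_def by blast

locale discrete_geodesic_space =
  fixes X :: "'a set" and d :: "'a \<Rightarrow> 'a \<Rightarrow> nat"
  assumes dist_zero: "\<lbrakk>x \<in> X; y \<in> X\<rbrakk> \<Longrightarrow> d x y = 0 \<longleftrightarrow> x = y"
    and dist_sym: "\<lbrakk>x \<in> X; y \<in> X\<rbrakk> \<Longrightarrow> d x y = d y x"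
    and dist_triangle: "\<lbrakk>x \<in> X; y \<in> X; z \<in> X\<rbrakk> \<Longrightarrow> d x z \<le> d x y + d y z"
    and point_at: "\<lbrakk>x \<in> X; y \<in> X; k \<le> d x y\<rbrakk> \<Longrightarrow> \<exists>p\<in>X. d x p = k \<and> between d x p y"
begin

lemma dist_self [simp]: "x \<in> X \<Longrightarrow> d x x = 0"
  using dist_zero by blast

lemma between_sym: "\<lbrakk>x \<in> X; y \<in> X; p \<in> X; between d x p y\<rbrakk> \<Longrightarrow> between d y p x"
  unfolding between_def using dist_sym by (metis add.commute)

lemma between_ends: "\<lbrakk>x \<in> X; y \<in> X\<rbrakk> \<Longrightarrow> between d x x y \<and> between d x y y"
  unfolding between_def by simp

lemma geodesic_seqI:
  assumes f: "\<And>i. i \<le> n \<Longrightarrow> f i \<in> X"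
    and step: "\<And>i. i < n \<Longrightarrow> d (f i) (f (Suc i)) \<le> 1"
    and ends: "n \<le> d (f 0) (f n)"
  shows "geodesic_seq X d f n"
proof -
  have le: "d (f i) (f j) \<le> j - i" if "i \<le> j" "j \<le> n" for i j
    using that
  proof (induction j rule: dec_induct)
    case base then show ?case using f by simp
  next
    case (step j)
    have "d (f i) (f (Suc j)) \<le> d (f i) (f j) + d (f j) (f (Suc j))"
      using step f by (intro dist_triangle) auto
    also have "\<dots> \<le> (j - i) + 1"
      using step assms(2)[of j] by (intro add_mono) auto
    finally show ?case using step by simp
  qed
  have "d (f i) (f j) = j - i" if ij: "i \<le> j" "j \<le> n" for i j
  proof -
    have "d (f 0) (f n) \<le> d (f 0) (f i) + d (f i) (f n)"
      "d (f i) (f n) \<le> d (f i) (f j) + d (f j) (f n)"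
      using f ij by (auto intro!: dist_triangle)
    then show ?thesis using le[of 0 i] le[of i j] le[of j n] ij ends by linarith
  qed
  with f show ?thesis unfolding geodesic_seq_def by blast
qed

lemma geodesic_seq_exists:
  assumes "x \<in> X" "y \<in> X"
  shows "\<exists>f. geodesic_seq X d f (d x y) \<and> f 0 = x \<and> f (d x y) = y"
  using assms
proof (induction "d x y" arbitrary: x)
  case 0
  then have "x = y" by (simp add: dist_zero)
  then show ?case using 0 by (intro exI[of _ "\<lambda>_. x"]) (auto simp: geodesic_seq_def)
next
  case (Suc n)
  then obtain p where p: "p \<in> X" "d x p = 1" "between d x p y"
    using point_at[of x y 1] by auto
  then have py: "n = d p y" using Suc by (simp add: between_def)
  obtain f where f: "geodesic_seq X d f n" "f 0 = p" "f n = y"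
    using Suc.hyps(1)[of p] py p Suc.prems by auto
  let ?g = "\<lambda>i. case i of 0 \<Rightarrow> x | Suc i \<Rightarrow> f i"
  have "geodesic_seq X d ?g (Suc n)"
  proof (rule geodesic_seqI)
    show "?g i \<in> X" if "i \<le> Suc n" for i
      using that f Suc.prems by (auto simp: geodesic_seq_def split: nat.split)
    show "d (?g i) (?g (Suc i)) \<le> 1" if "i < Suc n" for i
      using that f p by (cases i) (auto simp: geodesic_seq_def)
    show "Suc n \<le> d (?g 0) (?g (Suc n))" using eq_imp_le[OF Suc.hyps(2)] f by simp
  qed
  then show ?case using f by (intro exI[of _ ?g]) (simp add: Suc.hyps(2)[symmetric])
qed

lemma geodesic_seq_through:
  assumes "x \<in> X" "y \<in> X" "p \<in> X" "between d x p y"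
  shows "\<exists>f. geodesic_seq X d f (d x y) \<and> f 0 = x \<and> f (d x y) = y \<and> f (d x p) = p"
proof -
  obtain f g where f: "geodesic_seq X d f (d x p)" "f 0 = x" "f (d x p) = p"
    and g: "geodesic_seq X d g (d p y)" "g 0 = p" "g (d p y) = y"
    using geodesic_seq_exists assms by meson
  let ?n = "d x p"
  let ?h = "\<lambda>i. if i \<le> ?n then f i else g (i - ?n)"
  have n: "d x y = ?n + d p y" using assms by (simp add: between_def)
  have end_pt: "?h (d x y) = y"
    using f g n by (cases "d p y = 0") auto
  have "geodesic_seq X d ?h (d x y)"
  proof (rule geodesic_seqI)
    show "?h i \<in> X" if "i \<le> d x y" for i
      using that f g n by (auto simp: geodesic_seq_def)
    show "d (?h i) (?h (Suc i)) \<le> 1" if i: "i < d x y" for i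
    proof -
      consider "Suc i \<le> ?n" | "i = ?n" | "?n < i" by linarith
      then show ?thesis
      proof cases
        case 2
        then show ?thesis using f g i n by (auto simp: geodesic_seq_def)
      qed (use f g i n in \<open>auto simp: geodesic_seq_def Suc_diff_le\<close>)
    qed
    show "d x y \<le> d (?h 0) (?h (d x y))" using end_pt f by simp
  qed
  then show ?thesis using end_pt f by (intro exI[of _ ?h]) auto
qed

lemma geodesic_seq_between:
  assumes "geodesic_seq X d f n" "i \<le> n"
  shows "between d (f 0) (f i) (f n)"
  using assms unfolding geodesic_seq_def between_def by auto

text \<open>
  Apply thinness at \<open>p\<close> to the triangle with corners \<open>x\<close>, \<open>y\<close>, \<open>b\<close>: the point near \<open>p\<close> lies between
  \<open>b\<close> and one of the endpoints, and its distance to \<open>b\<close> is then a difference of distances to that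
  endpoint.
\<close>

lemma thin_bigon:
  assumes thin: "thin_triangles X d \<delta>"
    and X: "x \<in> X" "y \<in> X" "p \<in> X" "b \<in> X"
    and p: "between d x p y" and b: "between d x b y"
  shows "d p b \<le> (d x p - d x b) + (d x b - d x p) + 2 * \<delta>"
proof -
  obtain w where w: "w \<in> X" "d p w \<le> \<delta>" "between d x w b \<or> between d b w y"
    using thin X p unfolding thin_triangles_def by blast
  have *: "d p b \<le> d p w + d w b" "d x p \<le> d x w + d w p" "d p y \<le> d p w + d w y"
    using w X by (auto intro!: dist_triangle)
  have **: "d w p = d p w" "d w b = d b w" using w X by (auto intro!: dist_sym)
  show ?thesis
    using w(2,3) p b * ** unfolding between_def by auto
qed

text \<open>
  The path from \<open>x\<close> through \<open>z\<close> to \<open>y\<close> wastes at most \<open>c\<close>. The point \<open>a\<close> on its first half is near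
  the side from \<open>x\<close> to \<open>y\<close>, where the bigon estimate finishes, or near the side from \<open>z\<close> to \<open>y\<close>. In
  the latter case the path returns to the vicinity of \<open>a\<close> after \<open>z\<close>, so that the wasted length bounds
  the distance from \<open>a\<close> to the corner \<open>z\<close>. The corner itself is near a point \<open>e\<close> between \<open>x\<close> and \<open>y\<close>
  at the same distance from \<open>x\<close> (or \<open>e = y\<close> if \<open>z\<close> is farther from \<open>x\<close>): whichever of the other
  sides \<open>e\<close> is near to, the distances to the endpoints place it near \<open>z\<close>.
\<close>

lemma short_detour_fellow_travels:
  assumes thin: "thin_triangles X d \<delta>"
    and X: "x \<in> X" "y \<in> X" "z \<in> X" "a \<in> X" "b \<in> X"
    and detour: "d x z + d z y \<le> d x y + c"
    and a: "between d x a z" and b: "between d x b y"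
    and ab: "d x a \<le> d x b + c" "d x b \<le> d x a + c"
  shows "d a b \<le> 6 * \<delta> + 5 * c"
proof -
  obtain w where w: "w \<in> X" "d a w \<le> \<delta>" "between d x w y \<or> between d y w z"
    using thin X a unfolding thin_triangles_def by blast
  have tri: "d x y \<le> d x a + d a y" "d a y \<le> d a w + d w y" "d x w \<le> d x a + d a w"
    "d x a \<le> d x w + d w a" "d a b \<le> d a w + d w b" "d x y \<le> d x z + d z y"
    using w X by (auto intro!: dist_triangle)
  have sym: "d w a = d a w" "d z w = d w z" "d z y = d y z" "d w y = d y w"
    using w X by (auto intro!: dist_sym)
  from w(3) show ?thesis
  proof
    assume bw: "between d x w y"
    have "d w b \<le> (d x w - d x b) + (d x b - d x w) + 2 * \<delta>"
      using thin_bigon[OF thin X(1,2) w(1) X(5) bw b] .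
    then show ?thesis using tri sym w(2) ab by linarith
  next
    assume bw: "between d y w z"
    have az: "d a z \<le> \<delta> + c"
      using bw a tri sym w(2) detour unfolding between_def by linarith
    obtain e where e: "e \<in> X" "d x e = min (d x z) (d x y)" "between d x e y"
      using point_at[of x y "min (d x z) (d x y)"] X by auto
    obtain v where v: "v \<in> X" "d e v \<le> \<delta>" "between d x v z \<or> between d z v y"
      using thin X e unfolding thin_triangles_def by blast
    have tri': "d e z \<le> d e v + d v z" "d x e \<le> d x v + d v e" "d e y \<le> d e v + d v y"
      "d a b \<le> d a z + d z b" "d z b \<le> d z e + d e b"
      using X v(1) e(1) by (auto intro!: dist_triangle)
    have sym': "d v e = d e v" "d z v = d v z" "d z e = d e z"
      using X v(1) e(1) by (auto intro!: dist_sym)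
    have ez: "d e z \<le> c + 2 * \<delta>"
      using v(2,3) tri' sym' e(2,3) detour unfolding between_def by auto
    have "d e b \<le> (d x e - d x b) + (d x b - d x e) + 2 * \<delta>"
      using thin_bigon[OF thin X(1,2) e(1) X(5) e(3) b] .
    moreover have "d x e \<le> d x z" "d x z \<le> d x e + c"
      using e(2) detour by auto
    ultimately show ?thesis
      using az ez tri' sym' ab a unfolding between_def by linarith
  qed
qed

section \<open>Stability of quasi-geodesics\<close>

text \<open>
  Halving the chain costs \<open>\<delta>\<close> by thinness of the triangle on its two endpoints and its midpoint,
  and after \<open>k\<close> halvings only one step is left.
\<close>

lemma near_chain_logarithmic:
  assumes thin: "thin_triangles X d \<delta>"
    and f: "\<And>i. \<lbrakk>i \<le> n\<rbrakk> \<Longrightarrow> f i \<in> X"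
    and step: "\<And>i. i < n \<Longrightarrow> d (f i) (f (Suc i)) \<le> l"
    and "a \<le> b" "b \<le> n" "b - a \<le> 2 ^ k" "p \<in> X" "between d (f a) p (f b)"
  shows "\<exists>i\<le>n. d p (f i) \<le> k * \<delta> + l"
  using assms(4-8)
proof (induction k arbitrary: a b p)
  case 0
  then have "b = a \<or> b = Suc a" by auto
  then have "d (f a) (f b) \<le> l" using step[of a] f[of a] 0 by auto
  then have "d p (f b) \<le> l" using 0 unfolding between_def by simp
  then show ?case using 0 by auto
next
  case (Suc k)
  let ?m = "(a + b) div 2"
  have m: "a \<le> ?m" "?m \<le> b" "?m - a \<le> 2 ^ k" "b - ?m \<le> 2 ^ k" using Suc.prems by auto
  have X: "f a \<in> X" "f b \<in> X" "f ?m \<in> X" using f Suc.prems(2) m by auto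
  obtain w where w: "w \<in> X" "d p w \<le> \<delta>" "between d (f a) w (f ?m) \<or> between d (f ?m) w (f b)"
    using thin_trianglesE[OF thin X Suc.prems(4,5)] .
  have "\<exists>i\<le>n. d w (f i) \<le> k * \<delta> + l"
    using w(3)
  proof
    assume "between d (f a) w (f ?m)"
    then show ?thesis by (intro Suc.IH[of a ?m w]) (use m w(1) Suc.prems(2) in auto)
  next
    assume "between d (f ?m) w (f b)"
    then show ?thesis by (intro Suc.IH[of ?m b w]) (use m w(1) Suc.prems(2) in auto)
  qed
  then obtain i where i: "i \<le> n" "d w (f i) \<le> k * \<delta> + l" by blast
  have "d p (f i) \<le> d p w + d w (f i)" using Suc.prems w f i by (intro dist_triangle) auto
  with i w(2) show ?case by (intro exI[of _ i]) auto
qed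

text \<open>
  The classical argument for the Morse lemma. Let \<open>x\<close> be a point of a geodesic at the largest
  possible distance \<open>D\<close> from the quasi-geodesic. Walk from \<open>x\<close> by \<open>2 D\<close> in both directions (or up
  to the endpoint) and then jump by at most \<open>D\<close> to the quasi-geodesic, reaching \<open>f i\<close> and \<open>f j\<close>. The
  jumps stay at distance at least \<open>D\<close> from \<open>x\<close>, and \<open>f i\<close> and \<open>f j\<close> are at distance at most \<open>6 D\<close>, so
  that the piece of the quasi-geodesic between them has at most \<open>6 m D\<close> steps. As \<open>x\<close> is \<open>2 \<delta>\<close>-close to a jump
  or to a geodesic between \<open>f i\<close> and \<open>f j\<close>, the logarithmic estimate for chains bounds \<open>D\<close> by a
  logarithm of \<open>D\<close>.
\<close>

lemma geodesic_near_quasi_geodesic: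
  assumes thin: "thin_triangles X d \<delta>"
  shows "\<exists>D0. \<forall>f n p. quasi_geodesic_seq X d l m f n \<longrightarrow> p \<in> X \<longrightarrow> between d (f 0) p (f n) \<longrightarrow>
            (\<exists>i\<le>n. d p (f i) \<le> D0)"
proof -
  obtain B where B: "\<And>D. (\<And>k. 6 * m * D \<le> 2 ^ k \<Longrightarrow> D \<le> k * \<delta> + (2 * \<delta> + l)) \<Longrightarrow> D \<le> B"
    using logarithmic_bound_imp_bounded[of "6 * m" \<delta> "2 * \<delta> + l"] by blast
  have "\<exists>i\<le>n. d p (f i) \<le> B"
    if qg: "quasi_geodesic_seq X d l m f n" and pX: "p \<in> X" and p: "between d (f 0) p (f n)" for f n p
  proof -
    have fX: "f i \<in> X" if "i \<le> n" for i
      using qg that unfolding quasi_geodesic_seq_def by blast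
    have lip: "d (f i) (f (Suc i)) \<le> l" if "i < n" for i
    proof -
      have "d (f i) (f (Suc i)) \<le> l * (Suc i - i)"
        using qg that unfolding quasi_geodesic_seq_def by (meson Suc_leI le_SucI le_refl)
      then show ?thesis by simp
    qed
    have colip: "j - i \<le> m * d (f i) (f j)" if "i \<le> j" "j \<le> n" for i j
      using qg that unfolding quasi_geodesic_seq_def by blast
    define h where "h x = Min ((\<lambda>i. d x (f i)) ` {..n})" for x
    have h_le: "h x \<le> d x (f i)" if "i \<le> n" for x i
      using that unfolding h_def by (intro Min_le) auto
    have h_attained: "\<exists>i\<le>n. h x = d x (f i)" for x
    proof -
      have "h x \<in> (\<lambda>i. d x (f i)) ` {..n}" unfolding h_def by (intro Min_in) auto
      then show ?thesis by auto
    qed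
    let ?Q = "\<lambda>x. x \<in> X \<and> between d (f 0) x (f n)"
    have bounded: "h x < Suc (d (f 0) (f n))" if "?Q x" for x
      using h_le[of 0 x] fX[of 0] dist_sym[of x "f 0"] that unfolding between_def by simp
    obtain x where x: "?Q x" and x_max: "\<And>y. ?Q y \<Longrightarrow> h y \<le> h x"
      using ex_has_greatest_nat[of ?Q p h "Suc (d (f 0) (f n))"] bounded pX p by blast
    define D where "D = h x"
    have ends: "f 0 \<in> X" "f n \<in> X" using fX by auto
    \<comment> \<open>The step away from \<open>x\<close> towards an endpoint \<open>e\<close> of the quasi-geodesic.\<close>
    have retreat: "\<exists>y\<in>X. \<exists>i\<le>n. between d e y x \<and> d y x \<le> 2 * D \<and> d y (f i) \<le> D \<and>
                     (\<forall>w\<in>X. between d y w (f i) \<longrightarrow> D \<le> d x w)"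
      if e: "(e = f 0 \<and> e' = f n) \<or> (e = f n \<and> e' = f 0)" and bt: "between d e x e'" for e e'
    proof -
      have X: "e \<in> X" "e' \<in> X" "x \<in> X" using that ends x by auto
      show ?thesis
      proof (cases "d e x \<le> 2 * D")
        case True
        obtain i where i: "i \<le> n" "f i = e" using e by auto
        have "D \<le> d x w" if w: "w \<in> X" "between d e w (f i)" for w
          using w i h_le[OF i(1), of x] X dist_zero[of e w] unfolding between_def D_def by auto
        then show ?thesis
          using True X i between_ends[of e x] by (intro bexI[of _ e] exI[of _ i]) auto
      next
        case False
        obtain y where y: "y \<in> X" "d e y = d e x - 2 * D" "between d e y x"
          using point_at[of e x "d e x - 2 * D"] X by auto
        have yx: "d y x = 2 * D" using y False unfolding between_def by auto
        have "d e e' \<le> d e y + d y e'" "d y e' \<le> d y x + d x e'"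
          using X y(1) by (auto intro!: dist_triangle)
        then have "between d e y e'" using y(3) bt unfolding between_def by linarith
        then have "?Q y"
          using e y(1) between_sym[of e e' y] X by blast
        then have "h y \<le> D" using x_max unfolding D_def by blast
        then obtain i where i: "i \<le> n" "d y (f i) \<le> D" using h_attained[of y] by auto
        have "D \<le> d x w" if w: "w \<in> X" "between d y w (f i)" for w
        proof -
          have "d y x \<le> d y w + d w x" "d w x = d x w"
            using y w X by (auto intro!: dist_triangle dist_sym)
          then show ?thesis using yx w(2) i(2) unfolding between_def by linarith
        qed
        then show ?thesis using y yx i by (intro bexI[of _ y] exI[of _ i]) auto
      qed
    qed
    obtain y i where y: "y \<in> X" "i \<le> n" "between d (f 0) y x" "d y x \<le> 2 * D" "d y (f i) \<le> D"
      and y_far: "\<And>w. w \<in> X \<Longrightarrow> between d y w (f i) \<Longrightarrow> D \<le> d x w"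
      using retreat[of "f 0" "f n"] x by blast
    have "between d (f n) x (f 0)" using x ends between_sym by blast
    then obtain z j where z: "z \<in> X" "j \<le> n" "between d (f n) z x" "d z x \<le> 2 * D" "d z (f j) \<le> D"
      and z_far: "\<And>w. w \<in> X \<Longrightarrow> between d z w (f j) \<Longrightarrow> D \<le> d x w"
      using retreat[of "f n" "f 0"] by blast
    have X: "f i \<in> X" "f j \<in> X" "x \<in> X" using fX y z x by auto
    have "D \<le> B"
    proof (rule B)
      fix k assume k: "6 * m * D \<le> 2 ^ k"
      have sym: "d z x = d x z" "d (f n) z = d z (f n)" "d (f n) x = d x (f n)" "d y (f i) = d (f i) y"
        "d w x = d x w" if "w \<in> X" for w
        using X y z ends that by (auto intro!: dist_sym)
      have "d (f 0) (f n) \<le> d (f 0) y + d y (f n)" "d y (f n) \<le> d y z + d z (f n)"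
        "d y z \<le> d y x + d x z"
        using X y z ends by (auto intro!: dist_triangle)
      then have xyz: "between d y x z"
        using x y(3) z(3) sym[OF y(1)] unfolding between_def by linarith
      obtain w where w: "w \<in> X" "d x w \<le> \<delta>" "between d y w (f i) \<or> between d (f i) w z"
        using thin_trianglesE[OF thin y(1) z(1) X(1) X(3) xyz] .
      show "D \<le> k * \<delta> + (2 * \<delta> + l)"
      proof (cases "between d y w (f i)")
        case True
        then show ?thesis using y_far[OF w(1)] w(2) by linarith
      next
        case False
        then have "between d (f i) w z" using w by blast
        then obtain v where v: "v \<in> X" "d w v \<le> \<delta>" "between d (f i) v (f j) \<or> between d (f j) v z"
          using thin_trianglesE[OF thin X(1) z(1) X(2) w(1)] by blast
        have xv: "d x v \<le> d x w + d w v" using X w v by (intro dist_triangle) auto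
        show ?thesis
        proof (cases "between d (f j) v z")
          case True
          then have "between d z v (f j)" using between_sym X z v by blast
          then show ?thesis using z_far[OF v(1)] xv v w by linarith
        next
          case False
          then have v': "between d (f i) v (f j)" using v by blast
          have "d (f i) (f j) \<le> d (f i) y + d y (f j)" "d y (f j) \<le> d y z + d z (f j)"
            using X y z by (auto intro!: dist_triangle)
          then have ij: "d (f i) (f j) \<le> 6 * D"
            using \<open>d y z \<le> d y x + d x z\<close> y z sym[OF y(1)] by linarith
          then have "m * d (f i) (f j) \<le> 6 * m * D" using mult_le_mono2[OF ij, of m] by simp
          then have diff: "m * d (f i) (f j) \<le> 2 ^ k" using k by (rule le_trans)
          have "\<exists>t\<le>n. d v (f t) \<le> k * \<delta> + l"
          proof (cases "i \<le> j")
            case True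
            show ?thesis
              by (rule near_chain_logarithmic[OF thin fX lip True z(2) _ v(1) v'])
                 (use colip[OF True z(2)] diff in auto)
          next
            case False
            then have "j \<le> i" by simp
            have "d (f i) (f j) = d (f j) (f i)" using X dist_sym by blast
            then have "i - j \<le> 2 ^ k" using colip[OF \<open>j \<le> i\<close> y(2)] diff by simp
            show ?thesis
              by (rule near_chain_logarithmic[OF thin fX lip \<open>j \<le> i\<close> y(2) _ v(1)
                      between_sym[OF X(1,2) v(1) v']])
                 (use \<open>i - j \<le> 2 ^ k\<close> in auto)
          qed
          then obtain t where t: "t \<le> n" "d v (f t) \<le> k * \<delta> + l" by blast
          have "d x (f t) \<le> d x v + d v (f t)" using X v fX t by (intro dist_triangle) auto
          moreover have "D \<le> d x (f t)" using h_le t unfolding D_def by blast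
          ultimately show ?thesis using xv v(2) w(2) t(2) by linarith
        qed
      qed
    qed
    then have "h p \<le> B" using x_max pX p unfolding D_def by (meson le_trans)
    then show ?thesis using h_attained[of p] by auto
  qed
  then show ?thesis by blast
qed

text \<open>
  Move along a geodesic from \<open>f 0\<close> to \<open>f n\<close>. Each of its points is near some \<open>f i\<close>, at the start with
  \<open>i \<le> t\<close> and at the end with \<open>i \<ge> t\<close>. Where this changes, one point is near both \<open>f i\<close> and \<open>f j\<close> with
  \<open>i \<le> t \<le> j\<close>; then \<open>f i\<close> and \<open>f j\<close> are close, so \<open>j - i\<close> is bounded and \<open>f t\<close> is close, too.
\<close>

lemma quasi_geodesic_near_geodesic:
  assumes thin: "thin_triangles X d \<delta>"
  shows "\<exists>D1. \<forall>f n t. quasi_geodesic_seq X d l m f n \<longrightarrow> t \<le> n \<longrightarrow>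
            (\<exists>w\<in>X. between d (f 0) w (f n) \<and> d (f t) w \<le> D1)"
proof -
  obtain D0 where D0: "\<And>f n p. \<lbrakk>quasi_geodesic_seq X d l m f n; p \<in> X; between d (f 0) p (f n)\<rbrakk>
      \<Longrightarrow> \<exists>i\<le>n. d p (f i) \<le> D0"
    using geodesic_near_quasi_geodesic[OF thin] by meson
  let ?D1 = "l * (m * (2 * D0 + 1)) + D0"
  have "\<exists>w\<in>X. between d (f 0) w (f n) \<and> d (f t) w \<le> ?D1"
    if qg: "quasi_geodesic_seq X d l m f n" and t: "t \<le> n" for f n t
  proof -
    have fX: "f i \<in> X" if "i \<le> n" for i
      using qg that unfolding quasi_geodesic_seq_def by blast
    have lip: "d (f i) (f j) \<le> l * (j - i)" and colip: "j - i \<le> m * d (f i) (f j)"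
      if "i \<le> j" "j \<le> n" for i j
      using qg that unfolding quasi_geodesic_seq_def by blast+
    let ?N = "d (f 0) (f n)"
    obtain g where g: "geodesic_seq X d g ?N" "g 0 = f 0" "g ?N = f n"
      using geodesic_seq_exists fX by blast
    have gX: "g k \<in> X" and g_btw: "between d (f 0) (g k) (f n)" if "k \<le> ?N" for k
      using g geodesic_seq_between[OF g(1) that] that unfolding geodesic_seq_def by auto
    let ?low = "\<lambda>k. k \<le> ?N \<and> (\<exists>i\<le>t. d (g k) (f i) \<le> D0)"
    have low0: "?low 0" using g(2) fX[of 0] by auto
    \<comment> \<open>The geodesic starts near an early point and ends near a late point of the quasi-geodesic.\<close>
    have "\<exists>k\<le>?N. \<exists>i\<le>t. \<exists>j\<ge>t. j \<le> n \<and> d (g k) (f i) \<le> D0 \<and> d (g k) (f j) \<le> D0 + 1"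
    proof -
      obtain k where k: "?low k" and k_max: "\<And>k'. ?low k' \<Longrightarrow> k' \<le> k"
        using ex_has_greatest_nat[of ?low 0 "\<lambda>k. k" "Suc ?N"] low0 by (metis (no_types, lifting) le_imp_less_Suc)
      obtain i where i: "i \<le> t" "d (g k) (f i) \<le> D0" using k by blast
      show ?thesis
      proof (cases "k = ?N")
        case True
        then have "d (g k) (f n) \<le> D0 + 1" using g(3) fX by simp
        then show ?thesis using k i t by blast
      next
        case False
        then have k1: "Suc k \<le> ?N" using k by simp
        then have "\<not> ?low (Suc k)" using k_max[of "Suc k"] by auto
        then obtain j where j: "j \<le> n" "d (g (Suc k)) (f j) \<le> D0" "\<not> j \<le> t"
          using D0[OF qg gX[OF k1] g_btw[OF k1]] k1 by blast
        have "d (g k) (f j) \<le> d (g k) (g (Suc k)) + d (g (Suc k)) (f j)"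
          using gX k1 fX j by (intro dist_triangle) auto
        moreover have "d (g k) (g (Suc k)) = 1" using g(1) k1 unfolding geodesic_seq_def by auto
        ultimately have "d (g k) (f j) \<le> D0 + 1" using j by linarith
        moreover have "t \<le> j" using j by simp
        ultimately show ?thesis using k i j by blast
      qed
    qed
    then obtain k i j where k: "k \<le> ?N" and ij: "i \<le> t" "t \<le> j" "j \<le> n"
      and near: "d (g k) (f i) \<le> D0" "d (g k) (f j) \<le> D0 + 1" by blast
    have X: "g k \<in> X" "f i \<in> X" "f j \<in> X" "f t \<in> X" using gX k fX ij by auto
    have "d (f i) (f j) \<le> d (f i) (g k) + d (g k) (f j)" "d (f t) (g k) \<le> d (f t) (f i) + d (f i) (g k)"
      using X by (auto intro!: dist_triangle)
    moreover have "d (f i) (g k) = d (g k) (f i)" "d (f t) (f i) = d (f i) (f t)"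
      using X by (auto intro!: dist_sym)
    ultimately have fij: "d (f i) (f j) \<le> 2 * D0 + 1" and ft: "d (f t) (g k) \<le> d (f i) (f t) + D0"
      using near by linarith+
    have "t - i \<le> j - i" using ij by simp
    also have "\<dots> \<le> m * d (f i) (f j)" using colip ij by simp
    also have "\<dots> \<le> m * (2 * D0 + 1)" using fij by (rule mult_le_mono2)
    finally have "l * (t - i) \<le> l * (m * (2 * D0 + 1))" by (rule mult_le_mono2)
    then have "d (f t) (g k) \<le> ?D1" using ft lip[of i t] ij by linarith
    then show ?thesis using X g_btw k by blast
  qed
  then show ?thesis by blast
qed

end

text \<open>
  Hyperbolicity does not depend on the metric within a bilipschitz class: \<open>e\<close>-geodesics are
  quasi-geodesics for \<open>d\<close>, so an \<open>e\<close>-triangle is close to the \<open>d\<close>-triangle with the same corners.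
\<close>

lemma thin_triangles_bilipschitz:
  assumes "discrete_geodesic_space X d" "discrete_geodesic_space X e"
    and thin: "thin_triangles X d \<delta>"
    and de: "\<And>x y. \<lbrakk>x \<in> X; y \<in> X\<rbrakk> \<Longrightarrow> d x y \<le> l * e x y"
    and ed: "\<And>x y. \<lbrakk>x \<in> X; y \<in> X\<rbrakk> \<Longrightarrow> e x y \<le> m * d x y"
  shows "\<exists>\<delta>'. thin_triangles X e \<delta>'"
proof -
  interpret D: discrete_geodesic_space X d by fact
  interpret E: discrete_geodesic_space X e by fact
  have qg: "quasi_geodesic_seq X d l m f n" if f: "geodesic_seq X e f n" for f n
  proof -
    have "d (f i) (f j) \<le> l * (j - i) \<and> j - i \<le> m * d (f i) (f j)" if ij: "i \<le> j" "j \<le> n" for i j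
      using f ij de[of "f i" "f j"] ed[of "f i" "f j"] unfolding geodesic_seq_def
      by (metis le_trans)
    then show ?thesis using f unfolding quasi_geodesic_seq_def geodesic_seq_def by blast
  qed
  obtain D0 where D0: "\<And>f n p. \<lbrakk>quasi_geodesic_seq X d l m f n; p \<in> X; between d (f 0) p (f n)\<rbrakk>
      \<Longrightarrow> \<exists>i\<le>n. d p (f i) \<le> D0"
    using D.geodesic_near_quasi_geodesic[OF thin] by meson
  obtain D1 where D1: "\<And>f n t. \<lbrakk>quasi_geodesic_seq X d l m f n; t \<le> n\<rbrakk> \<Longrightarrow>
            \<exists>w\<in>X. between d (f 0) w (f n) \<and> d (f t) w \<le> D1"
    using D.quasi_geodesic_near_geodesic[OF thin] by meson
  have side: "\<exists>v\<in>X. between e a v b \<and> d w v \<le> D0"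
    if "a \<in> X" "b \<in> X" "w \<in> X" "between d a w b" for a b w
  proof -
    obtain f where f: "geodesic_seq X e f (e a b)" "f 0 = a" "f (e a b) = b"
      using E.geodesic_seq_exists[OF \<open>a \<in> X\<close> \<open>b \<in> X\<close>] by blast
    moreover have "between d (f 0) w (f (e a b))" using f that by simp
    ultimately obtain i where i: "i \<le> e a b" "d w (f i) \<le> D0"
      using D0[OF qg[OF f(1)] \<open>w \<in> X\<close>] by blast
    then show ?thesis
      using f E.geodesic_seq_between[OF f(1) i(1)] unfolding geodesic_seq_def by auto
  qed
  have "\<exists>v\<in>X. e p v \<le> m * (D1 + \<delta> + D0) \<and> (between e x v z \<or> between e z v y)"
    if X: "x \<in> X" "y \<in> X" "z \<in> X" "p \<in> X" and p: "between e x p y" for x y z p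
  proof -
    obtain f where f: "geodesic_seq X e f (e x y)" "f 0 = x" "f (e x y) = y" "f (e x p) = p"
      using E.geodesic_seq_through[OF X(1,2,4) p] by blast
    have "e x p \<le> e x y" using p unfolding between_def by simp
    then obtain u where u: "u \<in> X" "between d x u y" "d p u \<le> D1"
      using D1[OF qg[OF f(1)], of "e x p"] f by auto
    obtain w where w: "w \<in> X" "d u w \<le> \<delta>" "between d x w z \<or> between d z w y"
      using thin_trianglesE[OF thin X(1,2,3) u(1,2)] .
    obtain v where v: "v \<in> X" "d w v \<le> D0" "between e x v z \<or> between e z v y"
      using w side[of x z w] side[of z y w] X by blast
    have "d p v \<le> d p u + d u v" "d u v \<le> d u w + d w v"
      using X u w v by (auto intro!: D.dist_triangle)
    then have "d p v \<le> D1 + \<delta> + D0" using u w v by linarith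
    then have "e p v \<le> m * (D1 + \<delta> + D0)"
      using ed[OF X(4) v(1)] by (meson le_trans mult_le_mono2)
    then show ?thesis using v by blast
  qed
  then show ?thesis unfolding thin_triangles_def by blast
qed

section \<open>The word metric of a Cayley graph\<close>

locale cayley_graph = group G for G :: "('g, 'm) monoid_scheme" (structure) +
  fixes S :: "'g set"
  assumes gens: "symmetric_generating_set G S"
begin

abbreviation "cdist \<equiv> cayley_dist G S"

lemma S_closed: "s \<in> S \<Longrightarrow> s \<in> carrier G"
  and S_inv: "s \<in> S \<Longrightarrow> inv s \<in> S"
  and S_gen: "generate G S = carrier G"
  using gens unfolding symmetric_generating_set_def by auto

lemma adj_sym: "\<lbrakk>x \<in> carrier G; cayley_adj G S x y\<rbrakk> \<Longrightarrow> cayley_adj G S y x"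
  unfolding cayley_adj_def using S_closed S_inv by (metis inv_closed inv_solve_right m_closed)

lemma cayley_path_singleton: "x \<in> carrier G \<Longrightarrow> cayley_path G S x [x] x"
  unfolding cayley_path_def by simp

lemma cayley_path_edge:
  "\<lbrakk>x \<in> carrier G; s \<in> S\<rbrakk> \<Longrightarrow> cayley_path G S x [x, x \<otimes> s] (x \<otimes> s)"
  unfolding cayley_path_def cayley_adj_def using S_closed by auto

lemma cayley_path_append:
  assumes "cayley_path G S x \<alpha> y" "cayley_path G S y \<beta> z"
  shows "cayley_path G S x (\<alpha> @ tl \<beta>) z"
proof (cases \<beta>)
  case (Cons b \<gamma>)
  then show ?thesis
    using assms unfolding cayley_path_def
    by (cases \<gamma>) (auto simp: successively_append_iff)
qed (use assms in \<open>auto simp: cayley_path_def\<close>)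

lemma cayley_path_rev:
  assumes "cayley_path G S x \<alpha> y"
  shows "cayley_path G S y (rev \<alpha>) x"
proof -
  have "successively (\<lambda>u v. cayley_adj G S v u) \<alpha>"
    using assms adj_sym unfolding cayley_path_def by (auto intro: successively_mono)
  then show ?thesis
    using assms unfolding cayley_path_def by (auto simp: hd_rev last_rev)
qed

lemma cayley_path_translate:
  assumes "cayley_path G S x \<alpha> y" "g \<in> carrier G"
  shows "cayley_path G S (g \<otimes> x) (map ((\<otimes>) g) \<alpha>) (g \<otimes> y)"
proof -
  have "successively (\<lambda>u v. cayley_adj G S (g \<otimes> u) (g \<otimes> v)) \<alpha>"
  proof (rule successively_mono)
    show "successively (cayley_adj G S) \<alpha>" using assms(1) unfolding cayley_path_def by simp
    show "cayley_adj G S (g \<otimes> u) (g \<otimes> v)"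
      if uv: "u \<in> set \<alpha>" "v \<in> set \<alpha>" "cayley_adj G S u v" for u v
    proof -
      obtain s where "s \<in> S" "v = u \<otimes> s" using uv(3) unfolding cayley_adj_def by blast
      moreover have "u \<in> carrier G" using uv(1) assms(1) unfolding cayley_path_def by blast
      ultimately show ?thesis
        using assms(2) S_closed unfolding cayley_adj_def by (auto simp: m_assoc)
    qed
  qed
  then show ?thesis
    using assms unfolding cayley_path_def by (auto simp: hd_map last_map successively_map)
qed

lemma cayley_path_from_one:
  assumes "x \<in> carrier G"
  shows "\<exists>\<alpha>. cayley_path G S \<one> \<alpha> x"
proof -
  have "x \<in> generate G S" using assms S_gen by simp
  then show ?thesis
  proof induction
    case one
    then show ?case using cayley_path_singleton by blast
  next
    case (incl s)
    then show ?case using cayley_path_edge[of \<one> s] S_closed by auto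
  next
    case (inv s)
    then show ?case using cayley_path_edge[of \<one> "inv s"] S_closed S_inv by auto
  next
    case (eng g h)
    then have "g \<in> carrier G" using S_gen by simp
    with eng show ?case
      using cayley_path_append cayley_path_translate[of \<one> _ h g] by (metis r_one)
  qed
qed

lemma cayley_path_exists:
  assumes "x \<in> carrier G" "y \<in> carrier G"
  shows "\<exists>\<alpha>. cayley_path G S x \<alpha> y"
proof -
  obtain \<alpha> where "cayley_path G S \<one> \<alpha> (inv x \<otimes> y)"
    using cayley_path_from_one[of "inv x \<otimes> y"] assms by auto
  from cayley_path_translate[OF this assms(1)] show ?thesis
    using assms by (auto simp flip: m_assoc)
qed

lemma dist_le_path: "cayley_path G S x \<alpha> y \<Longrightarrow> cdist x y \<le> length \<alpha> - 1"
  unfolding cayley_dist_def by (rule Least_le) (auto simp: cayley_path_def)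

lemma cayley_geodesic_exists:
  assumes "x \<in> carrier G" "y \<in> carrier G"
  shows "\<exists>\<alpha>. cayley_geodesic G S x \<alpha> y"
proof -
  let ?P = "\<lambda>n. \<exists>\<alpha>. cayley_path G S x \<alpha> y \<and> length \<alpha> = Suc n"
  obtain \<alpha> where "cayley_path G S x \<alpha> y" using cayley_path_exists assms by blast
  then have "?P (length \<alpha> - 1)" by (intro exI[of _ \<alpha>]) (auto simp: cayley_path_def)
  then have "?P (LEAST n. ?P n)" by (rule LeastI)
  then show ?thesis unfolding cayley_geodesic_def cayley_dist_def .
qed

lemma cayley_path_split:
  assumes "cayley_path G S x \<alpha> y" "k < length \<alpha>"
  shows "cayley_path G S x (take (Suc k) \<alpha>) (\<alpha> ! k)" "cayley_path G S (\<alpha> ! k) (drop k \<alpha>) y"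
proof -
  have "successively (cayley_adj G S) (take k \<alpha> @ drop k \<alpha>)"
    "successively (cayley_adj G S) (take (Suc k) \<alpha> @ drop (Suc k) \<alpha>)"
    using assms(1) unfolding cayley_path_def append_take_drop_id by auto
  then have "successively (cayley_adj G S) (drop k \<alpha>)"
    "successively (cayley_adj G S) (take (Suc k) \<alpha>)"
    by (auto simp only: successively_append_iff)
  moreover have "length \<alpha> - Suc 0 = k" if "length \<alpha> \<le> Suc k" using that assms(2) by simp
  ultimately show "cayley_path G S x (take (Suc k) \<alpha>) (\<alpha> ! k)" "cayley_path G S (\<alpha> ! k) (drop k \<alpha>) y"
    using assms unfolding cayley_path_def
    by (auto simp: hd_drop_conv_nth last_conv_nth min_def dest: in_set_takeD in_set_dropD)
qed

lemma dist_triangle_ineq: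
  assumes "x \<in> carrier G" "y \<in> carrier G" "z \<in> carrier G"
  shows "cdist x z \<le> cdist x y + cdist y z"
proof -
  obtain \<alpha> \<beta> where g: "cayley_geodesic G S x \<alpha> y" "cayley_geodesic G S y \<beta> z"
    using cayley_geodesic_exists assms by meson
  then have "cdist x z \<le> length (\<alpha> @ tl \<beta>) - 1"
    unfolding cayley_geodesic_def using cayley_path_append dist_le_path by blast
  then show ?thesis using g unfolding cayley_geodesic_def by simp
qed

lemma dist_commute:
  assumes "x \<in> carrier G" "y \<in> carrier G"
  shows "cdist x y = cdist y x"
proof -
  have "cdist y x \<le> cdist x y" if xy: "x \<in> carrier G" "y \<in> carrier G" for x y
  proof -
    obtain \<alpha> where "cayley_geodesic G S x \<alpha> y" using cayley_geodesic_exists[OF xy] by blast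
    then show ?thesis
      using dist_le_path[OF cayley_path_rev, of x \<alpha> y] unfolding cayley_geodesic_def by simp
  qed
  then show ?thesis using assms by (simp add: le_antisym)
qed

lemma dist_translate:
  assumes "x \<in> carrier G" "y \<in> carrier G" "g \<in> carrier G"
  shows "cdist (g \<otimes> x) (g \<otimes> y) = cdist x y"
proof -
  have le: "cdist (g \<otimes> x) (g \<otimes> y) \<le> cdist x y"
    if xyg: "x \<in> carrier G" "y \<in> carrier G" "g \<in> carrier G" for g x y
  proof -
    obtain \<alpha> where "cayley_geodesic G S x \<alpha> y" using cayley_geodesic_exists[OF xyg(1,2)] by blast
    then show ?thesis
      using dist_le_path[OF cayley_path_translate[OF _ xyg(3)], of x \<alpha> y]
      unfolding cayley_geodesic_def by simp
  qed
  have "inv g \<otimes> (g \<otimes> x) = x" "inv g \<otimes> (g \<otimes> y) = y"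
    using assms by (simp_all flip: m_assoc)
  then show ?thesis
    using le[of x y g] le[of "g \<otimes> x" "g \<otimes> y" "inv g"] assms by simp
qed

lemma dist_from_one: "\<lbrakk>x \<in> carrier G; y \<in> carrier G\<rbrakk> \<Longrightarrow> cdist x y = cdist \<one> (inv x \<otimes> y)"
  using dist_translate[of x y "inv x"] by simp

lemma dist_edge: "\<lbrakk>x \<in> carrier G; s \<in> S\<rbrakk> \<Longrightarrow> cdist x (x \<otimes> s) \<le> 1"
  using dist_le_path[OF cayley_path_edge[of x s]] by simp

lemma dist_eq_one_imp_adj:
  assumes "x \<in> carrier G" "y \<in> carrier G" "cdist x y = 1"
  shows "cayley_adj G S x y"
proof -
  obtain \<alpha> where "cayley_path G S x \<alpha> y" "length \<alpha> = Suc (Suc 0)"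
    using cayley_geodesic_exists assms unfolding cayley_geodesic_def by fastforce
  then show ?thesis unfolding cayley_path_def by (auto simp: length_Suc_conv)
qed

lemma cayley_geodesic_nth:
  assumes g: "cayley_geodesic G S x \<alpha> y" and X: "x \<in> carrier G" "y \<in> carrier G" and k: "k \<le> cdist x y"
  shows "\<alpha> ! k \<in> carrier G" "cdist x (\<alpha> ! k) = k" "between cdist x (\<alpha> ! k) y"
proof -
  have k': "k < length \<alpha>" and p: "cayley_path G S x \<alpha> y"
    using g k unfolding cayley_geodesic_def by auto
  show c: "\<alpha> ! k \<in> carrier G" using p k' unfolding cayley_path_def by auto
  have "cdist x (\<alpha> ! k) \<le> k" "cdist (\<alpha> ! k) y \<le> cdist x y - k"
    using dist_le_path[OF cayley_path_split(1)[OF p k']] dist_le_path[OF cayley_path_split(2)[OF p k']]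
      k' g unfolding cayley_geodesic_def by auto
  then show "cdist x (\<alpha> ! k) = k" "between cdist x (\<alpha> ! k) y"
    using dist_triangle_ineq[OF X(1) c X(2)] k unfolding between_def by linarith+
qed

lemma cayley_geodesic_between:
  assumes g: "cayley_geodesic G S x \<alpha> y" and X: "x \<in> carrier G" "y \<in> carrier G" and p: "p \<in> set \<alpha>"
  shows "p \<in> carrier G" "between cdist x p y"
proof -
  obtain k where "k < length \<alpha>" "p = \<alpha> ! k" using p by (metis in_set_conv_nth)
  then show "p \<in> carrier G" "between cdist x p y"
    using cayley_geodesic_nth[OF g X, of k] g unfolding cayley_geodesic_def by auto
qed

lemma cayley_geodesic_through:
  assumes "x \<in> carrier G" "y \<in> carrier G" "p \<in> carrier G" "between cdist x p y"
  shows "\<exists>\<alpha>. cayley_geodesic G S x \<alpha> y \<and> p \<in> set \<alpha>"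
proof -
  obtain \<alpha> \<beta> where g: "cayley_geodesic G S x \<alpha> p" "cayley_geodesic G S p \<beta> y"
    using cayley_geodesic_exists assms by meson
  then have "cayley_geodesic G S x (\<alpha> @ tl \<beta>) y"
    using assms(4) cayley_path_append[of x \<alpha> p \<beta> y] unfolding cayley_geodesic_def between_def by simp
  moreover have "p \<in> set \<alpha>" using g(1) unfolding cayley_geodesic_def cayley_path_def by auto
  ultimately show ?thesis by auto
qed

sublocale metric: discrete_geodesic_space "carrier G" cdist
proof
  fix x y z assume x: "x \<in> carrier G" and y: "y \<in> carrier G"
  show "cdist x y = cdist y x" using x y by (rule dist_commute)
  show "cdist x y = 0 \<longleftrightarrow> x = y"
  proof
    assume "cdist x y = 0"
    then obtain \<alpha> where "cayley_path G S x \<alpha> y" "length \<alpha> = Suc 0"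
      using cayley_geodesic_exists[OF x y] unfolding cayley_geodesic_def by auto
    then show "x = y" unfolding cayley_path_def by (auto simp: length_Suc_conv)
  next
    assume "x = y"
    then show "cdist x y = 0" using dist_le_path[OF cayley_path_singleton[OF x]] by simp
  qed
  show "\<exists>p\<in>carrier G. cdist x p = k \<and> between cdist x p y" if "k \<le> cdist x y" for k
    using cayley_geodesic_exists[OF x y] cayley_geodesic_nth[OF _ x y that] by blast
  show "cdist x z \<le> cdist x y + cdist y z" if "z \<in> carrier G"
    using x y that by (rule dist_triangle_ineq)
qed

text \<open>
  A homomorphism maps the finitely many edges at the identity to pairs at bounded distance, and by
  translation invariance the same bound holds for every edge.
\<close>

lemma hom_lipschitz:
  assumes "finite S" "cayley_graph H T" "h \<in> hom G H"
  shows "\<exists>K. \<forall>x\<in>carrier G. \<forall>y\<in>carrier G. cayley_dist H T (h x) (h y) \<le> K * cdist x y"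
proof -
  interpret H: cayley_graph H T by fact
  interpret h: group_hom G H h
    by unfold_locales (rule assms(3))
  define K where "K = Max (insert 0 ((\<lambda>s. H.cdist \<one>\<^bsub>H\<^esub> (h s)) ` S))"
  have K: "H.cdist \<one>\<^bsub>H\<^esub> (h s) \<le> K" if "s \<in> S" for s
    unfolding K_def using that \<open>finite S\<close> by (intro Max_ge) auto
  have "H.cdist (h x) (h y) \<le> K * cdist x y" if "x \<in> carrier G" "y \<in> carrier G" for x y
    using that
  proof (induction "cdist x y" arbitrary: x)
    case 0
    then show ?case using metric.dist_zero[of x y] by simp
  next
    case (Suc n)
    obtain p where p: "p \<in> carrier G" "cdist x p = 1" "between cdist x p y"
      using metric.point_at[of x y 1] Suc by auto
    then have n: "n = cdist p y" "cdist x y = 1 + cdist p y" using Suc(2) unfolding between_def by auto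
    obtain s where s: "s \<in> S" "p = x \<otimes> s"
      using dist_eq_one_imp_adj[of x p] p Suc unfolding cayley_adj_def by auto
    have "H.cdist (h x) (h p) = H.cdist (h x \<otimes>\<^bsub>H\<^esub> \<one>\<^bsub>H\<^esub>) (h x \<otimes>\<^bsub>H\<^esub> h s)"
      using s Suc.prems S_closed by simp
    also have "\<dots> \<le> K"
      using s K Suc.prems S_closed by (subst H.dist_translate) auto
    finally have "H.cdist (h x) (h p) \<le> K" .
    moreover have "H.cdist (h p) (h y) \<le> K * cdist p y" using Suc.hyps(1)[OF n(1) p(1)] Suc.prems by simp
    moreover have "H.cdist (h x) (h y) \<le> H.cdist (h x) (h p) + H.cdist (h p) (h y)"
      using Suc.prems p by (intro H.dist_triangle_ineq) auto
    ultimately show ?case by (simp add: n(2))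
  qed
  then show ?thesis by blast
qed

lemma hyperbolic_imp_thin_triangles:
  assumes "hyperbolic_cayley_graph G S \<delta>"
  shows "thin_triangles (carrier G) cdist (nat \<lfloor>\<delta>\<rfloor>)"
  unfolding thin_triangles_def
proof (intro ballI impI)
  fix x y z p assume X: "x \<in> carrier G" "y \<in> carrier G" "z \<in> carrier G" "p \<in> carrier G"
    and p: "between cdist x p y"
  obtain \<alpha> where \<alpha>: "cayley_geodesic G S x \<alpha> y" "p \<in> set \<alpha>"
    using cayley_geodesic_through[OF X(1,2,4) p] by blast
  obtain \<beta> \<gamma> where \<beta>\<gamma>: "cayley_geodesic G S y \<beta> z" "cayley_geodesic G S z \<gamma> x"
    using cayley_geodesic_exists X by meson
  obtain w where w: "w \<in> set \<beta> \<union> set \<gamma>" "real (cdist p w) \<le> \<delta>"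
    using assms X \<alpha> \<beta>\<gamma> unfolding hyperbolic_cayley_graph_def cayley_nbhd_def by blast
  have "w \<in> carrier G \<and> (between cdist y w z \<or> between cdist z w x)"
    using w(1) cayley_geodesic_between[OF \<beta>\<gamma>(1) X(2,3)] cayley_geodesic_between[OF \<beta>\<gamma>(2) X(3,1)] by blast
  moreover have "cdist p w \<le> nat \<lfloor>\<delta>\<rfloor>" using w(2) by (simp add: le_nat_floor)
  ultimately show "\<exists>w\<in>carrier G. cdist p w \<le> nat \<lfloor>\<delta>\<rfloor> \<and> (between cdist x w z \<or> between cdist z w y)"
    using metric.between_sym X by blast
qed

end

lemma thin_triangles_change_generators:
  assumes "cayley_graph G S" "cayley_graph G T" "finite S" "finite T"
    and "thin_triangles (carrier G) (cayley_dist G S) \<delta>"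
  shows "\<exists>\<delta>'. thin_triangles (carrier G) (cayley_dist G T) \<delta>'"
proof -
  interpret S: cayley_graph G S by fact
  interpret T: cayley_graph G T by fact
  have id: "(\<lambda>x. x) \<in> hom G G" by (auto simp: hom_def)
  obtain l where "\<And>x y. \<lbrakk>x \<in> carrier G; y \<in> carrier G\<rbrakk> \<Longrightarrow> S.cdist x y \<le> l * T.cdist x y"
    using T.hom_lipschitz[OF \<open>finite T\<close> assms(1) id] by blast
  moreover obtain m where "\<And>x y. \<lbrakk>x \<in> carrier G; y \<in> carrier G\<rbrakk> \<Longrightarrow> T.cdist x y \<le> m * S.cdist x y"
    using S.hom_lipschitz[OF \<open>finite S\<close> assms(2) id] by blast
  ultimately show ?thesis
    by (rule thin_triangles_bilipschitz[OF S.metric.discrete_geodesic_space_axioms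
          T.metric.discrete_geodesic_space_axioms assms(5)])
qed

section \<open>The hyperbolic bounded reduction property\<close>

text \<open>
  Both sides of the equivalence reduce to this property. In a hyperbolic graph it means that images
  of geodesics stay near geodesics, but it only speaks of distances.
\<close>

definition coarsely_preserves_geodesics ::
  "('g, 'm) monoid_scheme \<Rightarrow> 'g set \<Rightarrow> ('g \<Rightarrow> 'g) \<Rightarrow> bool" where
  "coarsely_preserves_geodesics G S \<phi> \<longleftrightarrow>
     (\<exists>c::nat. \<forall>x\<in>carrier G. \<forall>y\<in>carrier G. \<forall>p\<in>carrier G. between (cayley_dist G S) x p y \<longrightarrow>
        cayley_dist G S (\<phi> x) (\<phi> p) + cayley_dist G S (\<phi> p) (\<phi> y)
          \<le> cayley_dist G S (\<phi> x) (\<phi> y) + c)"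

context cayley_graph
begin

lemma hyp_BRP_hausdorff_imp_nbhd:
  assumes \<phi>: "\<phi> \<in> carrier G \<rightarrow> carrier G" and "hyp_BRP_hausdorff G S \<phi>"
  shows "hyp_BRP_nbhd G S \<phi>"
proof -
  obtain N :: nat where N: "\<And>x y \<alpha> \<beta>. \<lbrakk>x \<in> carrier G; y \<in> carrier G; cayley_geodesic G S x \<alpha> y;
      cayley_geodesic G S (\<phi> x) \<beta> (\<phi> y)\<rbrakk> \<Longrightarrow> hausdorff_distance G S (\<phi> ` set \<alpha>) (set \<beta>) \<le> real N"
    using assms(2) unfolding hyp_BRP_hausdorff_def by blast
  have "\<phi> ` set \<alpha> \<subseteq> cayley_nbhd G S (real (Suc N)) (set \<beta>)"
    if X: "x \<in> carrier G" "y \<in> carrier G" and \<alpha>: "cayley_geodesic G S x \<alpha> y"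
      and \<beta>: "cayley_geodesic G S (\<phi> x) \<beta> (\<phi> y)" for x y \<alpha> \<beta>
  proof -
    let ?X = "\<phi> ` set \<alpha>" and ?Y = "set \<beta>"
    let ?R = "{r. 0 \<le> r \<and> ?X \<subseteq> cayley_nbhd G S r ?Y \<and> ?Y \<subseteq> cayley_nbhd G S r ?X}"
    have fin: "?X \<noteq> {}" "?Y \<noteq> {}" "?X \<subseteq> carrier G" "?Y \<subseteq> carrier G"
      using \<alpha> \<beta> \<phi> unfolding cayley_geodesic_def cayley_path_def by auto
    \<comment> \<open>The infimum is over a nonempty set: the largest distance between the two sets belongs to it.\<close>
    define M where "M = Max ((\<lambda>(u, v). cdist u v) ` (?X \<times> ?Y))"
    have M: "cdist u v \<le> M" if "u \<in> ?X" "v \<in> ?Y" for u v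
      unfolding M_def using that by (intro Max_ge) (auto intro!: image_eqI[where x = "(u, v)"])
    have "?X \<subseteq> cayley_nbhd G S (real M) ?Y"
    proof
      fix u assume u: "u \<in> ?X"
      obtain v where "v \<in> ?Y" using fin(2) ex_in_conv by metis
      then show "u \<in> cayley_nbhd G S (real M) ?Y"
        using M[OF u] u fin(3) unfolding cayley_nbhd_def by auto
    qed
    moreover have "?Y \<subseteq> cayley_nbhd G S (real M) ?X"
    proof
      fix v assume v: "v \<in> ?Y"
      obtain u where u: "u \<in> ?X" using fin(1) ex_in_conv by metis
      have "u \<in> carrier G" "v \<in> carrier G" using u v fin(3,4) by blast+
      then have "cdist v u \<le> M" using M[OF u v] dist_commute by metis
      then show "v \<in> cayley_nbhd G S (real M) ?X"
        using u v fin(4) unfolding cayley_nbhd_def by auto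
    qed
    ultimately have "real M \<in> ?R" by simp
    moreover have "Inf ?R < real (Suc N)"
      using N[OF X \<alpha> \<beta>] unfolding hausdorff_distance_def by simp
    ultimately obtain r where r: "r \<in> ?R" "r < real (Suc N)"
      using cInf_lessD[of ?R "real (Suc N)"] by blast
    have "cayley_nbhd G S r ?Y \<subseteq> cayley_nbhd G S (real (Suc N)) ?Y"
      unfolding cayley_nbhd_def using r(2) by (blast intro: order_trans less_imp_le)
    then show ?thesis using r(1) by blast
  qed
  then show ?thesis unfolding hyp_BRP_nbhd_def by blast
qed

text \<open>
  Passing through a point at distance at most \<open>N\<close> from a geodesic lengthens the way by at most \<open>2 N\<close>.
\<close>

lemma hyp_BRP_nbhd_imp_coarse:
  assumes \<phi>: "\<phi> \<in> carrier G \<rightarrow> carrier G" and "hyp_BRP_nbhd G S \<phi>"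
  shows "coarsely_preserves_geodesics G S \<phi>"
proof -
  obtain N :: nat where N: "\<And>x y \<alpha> \<beta>. \<lbrakk>x \<in> carrier G; y \<in> carrier G; cayley_geodesic G S x \<alpha> y;
      cayley_geodesic G S (\<phi> x) \<beta> (\<phi> y)\<rbrakk> \<Longrightarrow> \<phi> ` set \<alpha> \<subseteq> cayley_nbhd G S (real N) (set \<beta>)"
    using assms(2) unfolding hyp_BRP_nbhd_def by meson
  have "cdist (\<phi> x) (\<phi> p) + cdist (\<phi> p) (\<phi> y) \<le> cdist (\<phi> x) (\<phi> y) + 2 * N"
    if X: "x \<in> carrier G" "y \<in> carrier G" "p \<in> carrier G" and p: "between cdist x p y" for x y p
  proof -
    have Y: "\<phi> x \<in> carrier G" "\<phi> y \<in> carrier G" "\<phi> p \<in> carrier G" using X \<phi> by auto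
    obtain \<alpha> where \<alpha>: "cayley_geodesic G S x \<alpha> y" "p \<in> set \<alpha>"
      using cayley_geodesic_through[OF X p] by blast
    obtain \<beta> where \<beta>: "cayley_geodesic G S (\<phi> x) \<beta> (\<phi> y)" using cayley_geodesic_exists Y by blast
    obtain w where w: "w \<in> set \<beta>" "cdist (\<phi> p) w \<le> N"
      using N[OF X(1,2) \<alpha>(1) \<beta>] \<alpha>(2) unfolding cayley_nbhd_def by auto
    note w' = cayley_geodesic_between[OF \<beta> Y(1,2) w(1)]
    show ?thesis
      using dist_triangle_ineq[OF Y(1) w'(1) Y(3)] dist_triangle_ineq[OF Y(3) w'(1) Y(2)]
        dist_commute[OF w'(1) Y(3)] w(2) w'(2) unfolding between_def by linarith
  qed
  then show ?thesis unfolding coarsely_preserves_geodesics_def by blast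
qed

text \<open>
  Translation by \<open>x\<close> turns the Gromov product based at the identity into the one based at \<open>x\<close>.
\<close>

lemma gromov_product_at:
  assumes "x \<in> carrier G" "g \<in> carrier G" "h \<in> carrier G"
  shows "2 * gromov_product G S (inv x \<otimes> g) (inv x \<otimes> h)
           = real (cdist x g) + real (cdist x h) - real (cdist g h)"
  using dist_from_one[of x g] dist_from_one[of x h] dist_translate[of g h "inv x"] assms
  unfolding gromov_product_def by simp

lemma hyp_BRP_product_imp_zero:
  assumes "hyp_BRP_product G S \<phi>"
  shows "hyp_BRP_product_zero G S \<phi>"
proof -
  have "\<exists>q>0. \<forall>u\<in>carrier G. \<forall>v\<in>carrier G.
      gromov_product G S u v \<le> 1 \<longrightarrow> gromov_product G S (\<phi> u) (\<phi> v) \<le> q"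
    using assms unfolding hyp_BRP_product_def by (meson zero_less_one)
  then show ?thesis unfolding hyp_BRP_product_zero_def by (elim exE) (rule exI, auto)
qed

text \<open>
  By translation invariance the vanishing of the Gromov product says that the base point lies on a
  geodesic, and twice the Gromov product of the images is the excess length of the detour.
\<close>

lemma hyp_BRP_product_zero_iff_coarse:
  assumes "\<phi> \<in> hom G G"
  shows "hyp_BRP_product_zero G S \<phi> \<longleftrightarrow> coarsely_preserves_geodesics G S \<phi>"
proof
  interpret \<phi>: group_hom G G \<phi> by unfold_locales (rule assms)
  {
    assume "hyp_BRP_product_zero G S \<phi>"
    then obtain q where q: "\<And>u v. \<lbrakk>u \<in> carrier G; v \<in> carrier G; gromov_product G S u v = 0\<rbrakk>
        \<Longrightarrow> gromov_product G S (\<phi> u) (\<phi> v) \<le> q"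
      unfolding hyp_BRP_product_zero_def by blast
    have "cdist (\<phi> x) (\<phi> p) + cdist (\<phi> p) (\<phi> y) \<le> cdist (\<phi> x) (\<phi> y) + nat \<lceil>2 * q\<rceil>"
      if X: "x \<in> carrier G" "y \<in> carrier G" "p \<in> carrier G" and p: "between cdist x p y" for x y p
    proof -
      have "gromov_product G S (inv p \<otimes> x) (inv p \<otimes> y) = 0"
        using gromov_product_at[OF X(3,1,2)] dist_commute[OF X(1,3)] p unfolding between_def by simp
      then have "gromov_product G S (\<phi> (inv p \<otimes> x)) (\<phi> (inv p \<otimes> y)) \<le> q"
        using q[of "inv p \<otimes> x" "inv p \<otimes> y"] X by simp
      then have "2 * gromov_product G S (inv (\<phi> p) \<otimes> \<phi> x) (inv (\<phi> p) \<otimes> \<phi> y) \<le> 2 * q"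
        using X by simp
      then have "real (cdist (\<phi> p) (\<phi> x)) + real (cdist (\<phi> p) (\<phi> y)) - real (cdist (\<phi> x) (\<phi> y)) \<le> 2 * q"
        using gromov_product_at[of "\<phi> p" "\<phi> x" "\<phi> y"] X by simp
      moreover have "2 * q \<le> real (nat \<lceil>2 * q\<rceil>)" by (rule real_nat_ceiling_ge)
      ultimately show ?thesis using dist_commute[of "\<phi> x" "\<phi> p"] X by simp
    qed
    then show "coarsely_preserves_geodesics G S \<phi>"
      unfolding coarsely_preserves_geodesics_def by blast
  }
  assume "coarsely_preserves_geodesics G S \<phi>"
  then obtain c :: nat where c: "\<And>x y p. \<lbrakk>x \<in> carrier G; y \<in> carrier G; p \<in> carrier G; between cdist x p y\<rbrakk>
      \<Longrightarrow> cdist (\<phi> x) (\<phi> p) + cdist (\<phi> p) (\<phi> y) \<le> cdist (\<phi> x) (\<phi> y) + c"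
    unfolding coarsely_preserves_geodesics_def by blast
  have "gromov_product G S (\<phi> u) (\<phi> v) \<le> real c + 1"
    if X: "u \<in> carrier G" "v \<in> carrier G" and "gromov_product G S u v = 0" for u v
  proof -
    have "between cdist u \<one> v"
      using that dist_commute[of u \<one>] unfolding between_def gromov_product_def by simp
    then have "cdist (\<phi> u) \<one> + cdist \<one> (\<phi> v) \<le> cdist (\<phi> u) (\<phi> v) + c"
      using c[of u v \<one>] X by simp
    then show ?thesis
      using dist_commute[of "\<phi> u" \<one>] X unfolding gromov_product_def by simp
  qed
  then show "hyp_BRP_product_zero G S \<phi>"
    unfolding hyp_BRP_product_zero_def by (intro exI[of _ "real c + 1"]) auto
qed

lemma hyperbolic_BRP_iff_coarse:
  assumes "\<phi> \<in> hom G G"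
  shows "hyperbolic_BRP G S \<phi> \<longleftrightarrow> coarsely_preserves_geodesics G S \<phi>"
proof -
  have "\<phi> \<in> carrier G \<rightarrow> carrier G" using assms unfolding hom_def by blast
  then show ?thesis
    unfolding hyperbolic_BRP_def
    using hyp_BRP_hausdorff_imp_nbhd hyp_BRP_nbhd_imp_coarse hyp_BRP_product_imp_zero
      hyp_BRP_product_zero_iff_coarse[OF assms] by blast
qed

end

section \<open>Geodesic words and fellow travelling\<close>

lemma alphabet_evaluation:
  assumes "group G" "alphabet_for G A \<pi>"
  shows "symmetric_generating_set G (letter_image A \<pi>)"
    and "\<pi> [] = \<one>\<^bsub>G\<^esub>"
    and "\<And>u v. \<lbrakk>u \<in> lists A; v \<in> lists A\<rbrakk> \<Longrightarrow> \<pi> (u @ v) = \<pi> u \<otimes>\<^bsub>G\<^esub> \<pi> v"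
    and "\<And>u. u \<in> lists A \<Longrightarrow> \<pi> u \<in> carrier G"
proof -
  interpret group G by fact
  show app: "\<pi> (u @ v) = \<pi> u \<otimes>\<^bsub>G\<^esub> \<pi> v" if "u \<in> lists A" "v \<in> lists A" for u v
    using assms(2) that unfolding alphabet_for_def word_monoid_def hom_def by auto
  show closed: "\<pi> u \<in> carrier G" if "u \<in> lists A" for u
    using assms(2) that unfolding alphabet_for_def by blast
  show nil: "\<pi> [] = \<one>\<^bsub>G\<^esub>"
    using app[of "[]" "[]"] closed[of "[]"] by (simp add: l_cancel_one')
  let ?S = "letter_image A \<pi>"
  have S: "?S \<subseteq> carrier G" using closed unfolding letter_image_def by auto
  have "\<pi> w \<in> generate G ?S" if "w \<in> lists A" for w
    using that
  proof (induction w)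
    case Nil
    then show ?case using nil generate.one by metis
  next
    case (Cons a w)
    have "\<pi> [a] \<otimes>\<^bsub>G\<^esub> \<pi> w \<in> generate G ?S"
      using Cons by (intro generate.eng[OF generate.incl]) (auto simp: letter_image_def)
    then show ?case using app[of "[a]" w] Cons.hyps by simp
  qed
  then have "\<pi> ` lists A \<subseteq> generate G ?S" by (rule image_subsetI)
  then have "carrier G \<subseteq> generate G ?S" using assms(2) unfolding alphabet_for_def by simp
  moreover have "generate G ?S \<subseteq> carrier G" using S by (rule generate_incl)
  ultimately show "symmetric_generating_set G ?S"
    using S assms(2) unfolding symmetric_generating_set_def alphabet_for_def by blast
qed

locale word_group = group G for G :: "('g, 'm) monoid_scheme" (structure) +
  fixes A :: "'a set" and \<pi> :: "'a list \<Rightarrow> 'g"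
  assumes alphabet: "alphabet_for G A \<pi>"
begin

sublocale cayley_graph G "letter_image A \<pi>"
  by unfold_locales (rule alphabet_evaluation[OF is_group alphabet])

lemmas eval_Nil = alphabet_evaluation(2)[OF is_group alphabet]
  and eval_append = alphabet_evaluation(3)[OF is_group alphabet]
  and eval_closed = alphabet_evaluation(4)[OF is_group alphabet]

lemma dist_eval_le:
  assumes "x \<in> carrier G" "w \<in> lists A"
  shows "cdist x (x \<otimes> \<pi> w) \<le> length w"
  using assms(2,1)
proof (induction w arbitrary: x)
  case Nil
  then show ?case by (simp add: eval_Nil)
next
  case (Cons a w)
  have a: "\<pi> [a] \<in> carrier G" "\<pi> w \<in> carrier G" using Cons eval_closed by auto
  have "\<pi> (a # w) = \<pi> [a] \<otimes> \<pi> w" using eval_append[of "[a]" w] Cons.hyps by simp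
  then have eq: "x \<otimes> \<pi> (a # w) = (x \<otimes> \<pi> [a]) \<otimes> \<pi> w" using a Cons.prems by (simp add: m_assoc)
  have "cdist x (x \<otimes> \<pi> [a]) \<le> 1"
    using Cons by (intro dist_edge) (auto simp: letter_image_def)
  moreover have "cdist (x \<otimes> \<pi> [a]) ((x \<otimes> \<pi> [a]) \<otimes> \<pi> w) \<le> length w"
    using Cons a by simp
  ultimately show ?case
    using dist_triangle_ineq[of x "x \<otimes> \<pi> [a]" "(x \<otimes> \<pi> [a]) \<otimes> \<pi> w"] a Cons.prems eq by simp
qed

lemma geodesic_word_exists:
  assumes "g \<in> carrier G"
  shows "\<exists>w\<in>Geo G A \<pi>. \<pi> w = g"
proof -
  have "\<exists>w\<in>lists A. length w = cdist \<one> g \<and> \<pi> w = g"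
    using assms
  proof (induction "cdist \<one> g" arbitrary: g)
    case 0
    then show ?case using metric.dist_zero[of \<one> g] eval_Nil by auto
  next
    case (Suc n)
    obtain p where p: "p \<in> carrier G" "cdist \<one> p = n" "between cdist \<one> p g"
      using metric.point_at[of \<one> g n] Suc by auto
    then have "cdist p g = 1" using Suc.hyps(2) unfolding between_def by linarith
    then obtain a where a: "a \<in> A" "g = p \<otimes> \<pi> [a]"
      using dist_eq_one_imp_adj[of p g] p Suc.prems unfolding cayley_adj_def letter_image_def by auto
    obtain w where "w \<in> lists A" "length w = n" "\<pi> w = p" using Suc.hyps(1)[of p] p by auto
    then show ?case
      using a eval_append[of w "[a]"] Suc.hyps(2) by (intro bexI[of _ "w @ [a]"]) auto
  qed
  then show ?thesis unfolding Geo_def word_dist_def by auto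
qed

lemma Geo_D: "w \<in> Geo G A \<pi> \<Longrightarrow> w \<in> lists A \<and> length w = cdist \<one> (\<pi> w)"
  unfolding Geo_def word_dist_def by simp

lemma Geo_take:
  assumes "w \<in> Geo G A \<pi>"
  shows "\<pi> (take n w) \<in> carrier G" "cdist \<one> (\<pi> (take n w)) = min n (length w)"
    "between cdist \<one> (\<pi> (take n w)) (\<pi> w)"
proof -
  have w: "w \<in> lists A" "length w = cdist \<one> (\<pi> w)" using Geo_D[OF assms] by auto
  have parts: "take n w \<in> lists A" "drop n w \<in> lists A"
    using w(1) by (auto dest: in_set_takeD in_set_dropD)
  show c: "\<pi> (take n w) \<in> carrier G" using eval_closed parts by blast
  have "\<pi> w = \<pi> (take n w) \<otimes> \<pi> (drop n w)" using eval_append[OF parts] by simp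
  then have "cdist (\<pi> (take n w)) (\<pi> w) \<le> length w - n"
    using dist_eval_le[OF c parts(2)] by simp
  moreover have "cdist \<one> (\<pi> (take n w)) \<le> min n (length w)"
    using dist_eval_le[OF one_closed parts(1)] c by simp
  moreover have "cdist \<one> (\<pi> w) \<le> cdist \<one> (\<pi> (take n w)) + cdist (\<pi> (take n w)) (\<pi> w)"
    using c eval_closed w by (intro dist_triangle_ineq) auto
  ultimately show "cdist \<one> (\<pi> (take n w)) = min n (length w)"
    "between cdist \<one> (\<pi> (take n w)) (\<pi> w)"
    using w(2) unfolding between_def by linarith+
qed

text \<open>
  If \<open>p\<close> lies between \<open>x\<close> and \<open>y\<close>, then geodesic words for \<open>inv x \<otimes> p\<close> and \<open>inv p \<otimes> y\<close> concatenate to a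
  geodesic word, which fellow travels with itself. Fellow travelling of the image words, evaluated at
  the end of the first factor, puts \<open>\<phi> p\<close> near a geodesic from \<open>\<phi> x\<close> to \<open>\<phi> y\<close>.
\<close>

lemma FT_BRP_imp_coarse:
  assumes "\<phi> \<in> hom G G" and FT: "FT_BRP G \<phi> A \<pi> (Geo G A \<pi>) A \<pi> (Geo G A \<pi>)"
  shows "coarsely_preserves_geodesics G (letter_image A \<pi>) \<phi>"
proof -
  interpret \<phi>: group_hom G G \<phi> by unfold_locales (rule assms(1))
  obtain q where q: "\<And>u1 u2 u3 v1 v2 v3. \<lbrakk>u1 \<in> Geo G A \<pi>; u2 \<in> Geo G A \<pi>; u3 \<in> Geo G A \<pi>;
      v1 \<in> Geo G A \<pi>; v2 \<in> Geo G A \<pi>; v3 \<in> Geo G A \<pi>;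
      \<pi> v1 = \<phi> (\<pi> u1); \<pi> v2 = \<phi> (\<pi> u2); \<pi> v3 = \<phi> (\<pi> u3);
      meeting_fellow_travel G A \<pi> 0 (u1 @ u2) u3\<rbrakk> \<Longrightarrow> meeting_fellow_travel G A \<pi> q (v1 @ v2) v3"
    using FT unfolding FT_BRP_def by (metis order_refl)
  have "cdist (\<phi> x) (\<phi> p) + cdist (\<phi> p) (\<phi> y) \<le> cdist (\<phi> x) (\<phi> y) + 2 * nat \<lfloor>q\<rfloor>"
    if X: "x \<in> carrier G" "y \<in> carrier G" "p \<in> carrier G" and p: "between cdist x p y" for x y p
  proof -
    have prod: "inv x \<otimes> p \<otimes> (inv p \<otimes> y) = inv x \<otimes> y"
      using X by (metis inv_closed l_one m_assoc m_closed r_inv)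
    obtain u1 u2 where u: "u1 \<in> Geo G A \<pi>" "\<pi> u1 = inv x \<otimes> p" "u2 \<in> Geo G A \<pi>" "\<pi> u2 = inv p \<otimes> y"
      using geodesic_word_exists X by (metis inv_closed m_closed)
    have len: "length u1 = cdist x p" "length u2 = cdist p y"
      using Geo_D[OF u(1)] Geo_D[OF u(3)] u(2,4) dist_from_one[of x p] dist_from_one[of p y] X by auto
    have lists: "u1 \<in> lists A" "u2 \<in> lists A" using Geo_D u by auto
    have eval: "\<pi> (u1 @ u2) = inv x \<otimes> y" using eval_append[OF lists] u prod by simp
    have u3: "u1 @ u2 \<in> Geo G A \<pi>"
      using lists len p eval dist_from_one[OF X(1,2)]
      unfolding Geo_def word_dist_def between_def by auto
    have "\<pi> (take n (u1 @ u2)) \<in> carrier G" for n using Geo_take[OF u3] by blast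
    then have refl: "meeting_fellow_travel G A \<pi> 0 (u1 @ u2) (u1 @ u2)"
      unfolding meeting_fellow_travel_def fellow_travel_def word_dist_def
      by (simp del: take_append)
    obtain v1 v2 v3 where v: "v1 \<in> Geo G A \<pi>" "\<pi> v1 = inv (\<phi> x) \<otimes> \<phi> p"
      "v2 \<in> Geo G A \<pi>" "\<pi> v2 = inv (\<phi> p) \<otimes> \<phi> y" "v3 \<in> Geo G A \<pi>" "\<pi> v3 = inv (\<phi> x) \<otimes> \<phi> y"
    proof -
      have "inv (\<phi> x) \<otimes> \<phi> p \<in> carrier G" "inv (\<phi> p) \<otimes> \<phi> y \<in> carrier G" "inv (\<phi> x) \<otimes> \<phi> y \<in> carrier G"
        using X by auto
      then show thesis using geodesic_word_exists that by meson
    qed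
    have "\<pi> v1 = \<phi> (\<pi> u1)" "\<pi> v2 = \<phi> (\<pi> u2)" "\<pi> v3 = \<phi> (\<pi> (u1 @ u2))"
      unfolding eval using v u X by auto
    then have mft: "meeting_fellow_travel G A \<pi> q (v1 @ v2) v3"
      using q[OF u(1,3) u3 v(1,3,5)] refl by blast
    let ?z = "\<pi> v1" and ?b = "\<pi> (take (length v1) v3)"
    have "real (cdist ?z ?b) \<le> q"
      using mft unfolding meeting_fellow_travel_def fellow_travel_def word_dist_def
      by (auto dest: spec[of _ "length v1"])
    then have zb: "cdist ?z ?b \<le> nat \<lfloor>q\<rfloor>" by (simp add: le_nat_floor)
    have c: "?z \<in> carrier G" "\<pi> v3 \<in> carrier G" "?b \<in> carrier G"
      using v X Geo_take[OF v(5)] by auto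
    have d1: "cdist \<one> ?z = cdist (\<phi> x) (\<phi> p)" and d3: "cdist \<one> (\<pi> v3) = cdist (\<phi> x) (\<phi> y)"
      using v(2,6) X dist_from_one[of "\<phi> x" "\<phi> p"] dist_from_one[of "\<phi> x" "\<phi> y"] by auto
    have d2: "cdist ?z (\<pi> v3) = cdist (\<phi> p) (\<phi> y)"
      using v X dist_translate[of "\<phi> p" "\<phi> y" "inv (\<phi> x)"] by simp
    have "cdist \<one> ?z \<le> cdist \<one> ?b + cdist ?b ?z" "cdist ?z (\<pi> v3) \<le> cdist ?z ?b + cdist ?b (\<pi> v3)"
      using c by (auto intro!: dist_triangle_ineq)
    then show ?thesis
      using Geo_take(3)[OF v(5), of "length v1"] zb dist_commute[OF c(1,3)]
      unfolding d1 d2 d3 between_def by linarith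
  qed
  then show ?thesis unfolding coarsely_preserves_geodesics_def by blast
qed

text \<open>
  At time \<open>length u1\<close> the geodesic \<open>u3\<close> is near \<open>\<pi> u1\<close>. Its point there has an image with a bounded
  detour, and \<open>\<phi>\<close> is Lipschitz, so the detour through \<open>\<pi> v1\<close> from the identity to \<open>\<pi> v3\<close> is
  bounded, too. Thin triangles then make the two sides along \<open>v1\<close> and \<open>v2\<close> fellow travel with the
  third one: the part along \<open>v1\<close> is compared with it from the identity onwards and the part along
  \<open>v2\<close> from \<open>\<pi> v3\<close> backwards.
\<close>

lemma coarse_imp_FT_BRP:
  assumes "\<phi> \<in> hom G G" and thin: "thin_triangles (carrier G) cdist \<delta>"
    and "coarsely_preserves_geodesics G (letter_image A \<pi>) \<phi>"
  shows "FT_BRP G \<phi> A \<pi> (Geo G A \<pi>) A \<pi> (Geo G A \<pi>)"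
proof -
  interpret \<phi>: group_hom G G \<phi> by unfold_locales (rule assms(1))
  obtain c :: nat where c: "\<And>x y p. \<lbrakk>x \<in> carrier G; y \<in> carrier G; p \<in> carrier G; between cdist x p y\<rbrakk>
      \<Longrightarrow> cdist (\<phi> x) (\<phi> p) + cdist (\<phi> p) (\<phi> y) \<le> cdist (\<phi> x) (\<phi> y) + c"
    using assms(3) unfolding coarsely_preserves_geodesics_def by blast
  have "finite (letter_image A \<pi>)"
    using alphabet unfolding alphabet_for_def letter_image_def by simp
  then obtain K where K: "\<And>x y. \<lbrakk>x \<in> carrier G; y \<in> carrier G\<rbrakk> \<Longrightarrow> cdist (\<phi> x) (\<phi> y) \<le> K * cdist x y"
    using hom_lipschitz[OF _ cayley_graph_axioms assms(1)] by blast
  have bound: "meeting_fellow_travel G A \<pi> (real (6 * \<delta> + 5 * (c + 2 * (K * nat \<lfloor>p\<rfloor>)))) (v1 @ v2) v3"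
    if u: "u1 \<in> Geo G A \<pi>" "u2 \<in> Geo G A \<pi>" "u3 \<in> Geo G A \<pi>"
      and v: "v1 \<in> Geo G A \<pi>" "v2 \<in> Geo G A \<pi>" "v3 \<in> Geo G A \<pi>"
      and vu: "\<pi> v1 = \<phi> (\<pi> u1)" "\<pi> v2 = \<phi> (\<pi> u2)" "\<pi> v3 = \<phi> (\<pi> u3)"
      and mft: "meeting_fellow_travel G A \<pi> p (u1 @ u2) u3" for p u1 u2 u3 v1 v2 v3
  proof -
    let ?c = "c + 2 * (K * nat \<lfloor>p\<rfloor>)"
    have lists: "u1 \<in> lists A" "u2 \<in> lists A" "v1 \<in> lists A" "v2 \<in> lists A" "v3 \<in> lists A"
      using u v Geo_D by auto
    let ?x = "\<pi> (take (length u1) u3)"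
    let ?g = "\<pi> u1" and ?h = "\<pi> u3"
    have X: "?g \<in> carrier G" "?h \<in> carrier G" "?x \<in> carrier G" "\<pi> u2 \<in> carrier G"
      using u lists eval_closed Geo_D Geo_take[OF u(3)] by auto
    have h: "?h = ?g \<otimes> \<pi> u2"
      using mft eval_append[OF lists(1,2)] unfolding meeting_fellow_travel_def by simp
    have "real (cdist ?g ?x) \<le> p"
      using mft unfolding meeting_fellow_travel_def fellow_travel_def word_dist_def
      by (auto dest: spec[of _ "length u1"])
    then have "cdist ?g ?x \<le> nat \<lfloor>p\<rfloor>" by (simp add: le_nat_floor)
    then have gx: "cdist (\<phi> ?g) (\<phi> ?x) \<le> K * nat \<lfloor>p\<rfloor>"
      using K[OF X(1,3)] by (meson le_trans mult_le_mono2)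
    have "cdist \<one> (\<phi> ?x) + cdist (\<phi> ?x) (\<phi> ?h) \<le> cdist \<one> (\<phi> ?h) + c"
      using c[OF one_closed X(2,3) Geo_take(3)[OF u(3)]] by simp
    moreover have "cdist \<one> (\<phi> ?g) \<le> cdist \<one> (\<phi> ?x) + cdist (\<phi> ?x) (\<phi> ?g)"
      "cdist (\<phi> ?g) (\<phi> ?h) \<le> cdist (\<phi> ?g) (\<phi> ?x) + cdist (\<phi> ?x) (\<phi> ?h)"
      "cdist (\<phi> ?x) (\<phi> ?g) = cdist (\<phi> ?g) (\<phi> ?x)"
      using X by (auto intro!: dist_triangle_ineq dist_commute)
    ultimately have detour: "cdist \<one> (\<pi> v1) + cdist (\<pi> v1) (\<pi> v3) \<le> cdist \<one> (\<pi> v3) + ?c"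
      using gx unfolding vu by linarith
    have V: "\<pi> v1 \<in> carrier G" "\<pi> v2 \<in> carrier G" "\<pi> v3 \<in> carrier G" using eval_closed lists by auto
    have v3: "\<pi> v3 = \<pi> v1 \<otimes> \<pi> v2" using vu h X by simp
    then have meet: "\<pi> (v1 @ v2) = \<pi> v3" using eval_append lists by simp
    have len: "cdist \<one> (\<pi> v1) = length v1" "cdist (\<pi> v1) (\<pi> v3) = length v2" "cdist \<one> (\<pi> v3) = length v3"
      using v Geo_D dist_translate[of \<one> "\<pi> v2" "\<pi> v1"] V v3 by auto
    then have total: "length v3 \<le> length v1 + length v2" "length v1 + length v2 \<le> length v3 + ?c"
      using detour dist_triangle_ineq[OF one_closed V(1,3)] by auto
    have "cdist (\<pi> (take n (v1 @ v2))) (\<pi> (take n v3)) \<le> 6 * \<delta> + 5 * ?c" for n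
    proof -
      let ?b = "\<pi> (take n v3)"
      note b = Geo_take[OF v(3), of n]
      show ?thesis
      proof (cases "n \<le> length v1")
        case True
        let ?a = "\<pi> (take n v1)"
        note a = Geo_take[OF v(1), of n]
        have "cdist ?a ?b \<le> 6 * \<delta> + 5 * ?c"
          using True a b total
          by (intro metric.short_detour_fellow_travels[OF thin one_closed V(3,1) a(1) b(1) detour a(3) b(3)]) auto
        then show ?thesis using True by simp
      next
        case False
        \<comment> \<open>Past the corner the same estimate applies to the triangle read backwards from \<open>\<pi> v3\<close>.\<close>
        let ?m = "n - length v1"
        let ?a = "\<pi> v1 \<otimes> \<pi> (take ?m v2)"
        note a' = Geo_take[OF v(2), of ?m]
        have "take ?m v2 \<in> lists A" using lists by (auto dest: in_set_takeD)
        then have a_eq: "\<pi> (take n (v1 @ v2)) = ?a" using False eval_append lists by simp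
        have a: "?a \<in> carrier G" using V a' by simp
        have "cdist (\<pi> v1) ?a = cdist \<one> (\<pi> (take ?m v2))"
          "cdist ?a (\<pi> v3) = cdist (\<pi> (take ?m v2)) (\<pi> v2)"
          using dist_translate[of \<one> "\<pi> (take ?m v2)" "\<pi> v1"]
            dist_translate[of "\<pi> (take ?m v2)" "\<pi> v2" "\<pi> v1"] a'(1) V v3 by auto
        then have d: "cdist (\<pi> v1) ?a = min ?m (length v2)"
          "cdist ?a (\<pi> v3) = length v2 - min ?m (length v2)"
          using a'(2,3) Geo_D[OF v(2)] unfolding between_def by linarith+
        have "between cdist (\<pi> v1) ?a (\<pi> v3)" using d len unfolding between_def by simp
        then have ba: "between cdist (\<pi> v3) ?a (\<pi> v1)" using metric.between_sym V a by blast
        have bb: "between cdist (\<pi> v3) ?b \<one>" using metric.between_sym V b by blast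
        have rev: "cdist (\<pi> v3) (\<pi> v1) + cdist (\<pi> v1) \<one> \<le> cdist (\<pi> v3) \<one> + ?c"
          using detour dist_commute[of "\<pi> v3"] dist_commute[of "\<pi> v1" \<one>] V by simp
        have "cdist (\<pi> v3) ?a = length v2 - min ?m (length v2)" using d dist_commute V a by simp
        moreover have "cdist (\<pi> v3) ?b = length v3 - min n (length v3)"
          using b V dist_commute[of "\<pi> v3" ?b] len unfolding between_def by simp
        ultimately have "cdist (\<pi> v3) ?a \<le> cdist (\<pi> v3) ?b + ?c" "cdist (\<pi> v3) ?b \<le> cdist (\<pi> v3) ?a + ?c"
          using False total by linarith+
        then show ?thesis
          unfolding a_eq
          by (rule metric.short_detour_fellow_travels[OF thin V(3) one_closed V(1) a b(1) rev ba bb])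
      qed
    qed
    then show ?thesis
      using meet unfolding meeting_fellow_travel_def fellow_travel_def word_dist_def
      by (metis of_nat_le_iff)
  qed
  show ?thesis
    unfolding FT_BRP_def
  proof (intro allI impI)
    fix p :: real
    let ?q = "real (6 * \<delta> + 5 * (c + 2 * (K * nat \<lfloor>p\<rfloor>)))"
    show "\<exists>q\<ge>0. \<forall>u1\<in>Geo G A \<pi>. \<forall>u2\<in>Geo G A \<pi>. \<forall>u3\<in>Geo G A \<pi>.
        \<forall>v1\<in>Geo G A \<pi>. \<forall>v2\<in>Geo G A \<pi>. \<forall>v3\<in>Geo G A \<pi>.
          \<pi> v1 = \<phi> (\<pi> u1) \<and> \<pi> v2 = \<phi> (\<pi> u2) \<and> \<pi> v3 = \<phi> (\<pi> u3) \<longrightarrow>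
          meeting_fellow_travel G A \<pi> p (u1 @ u2) u3 \<longrightarrow> meeting_fellow_travel G A \<pi> q (v1 @ v2) v3"
      by (intro exI[of _ ?q] conjI ballI impI of_nat_0_le_iff bound) (elim conjE; assumption)+
  qed
qed

end

theorem corollary3p8:
  fixes G :: "('g, 'm) monoid_scheme" and A :: "'a set"
    and \<pi> :: "'a list \<Rightarrow> 'g" and \<phi> :: "'g \<Rightarrow> 'g"
  assumes "hyperbolic_group G"
    and "alphabet_for G A \<pi>"
    and "\<phi> \<in> hom G G"
  shows "FT_BRP G \<phi> A \<pi> (Geo G A \<pi>) A \<pi> (Geo G A \<pi>)
           \<longleftrightarrow> hyperbolic_BRP G (letter_image A \<pi>) \<phi>"
proof -
  obtain S \<delta> where "group G" and S: "finite S" "symmetric_generating_set G S" "hyperbolic_cayley_graph G S \<delta>"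
    using assms(1) unfolding hyperbolic_group_def by blast
  then interpret word_group G A \<pi>
    using assms(2) by (simp add: word_group_def word_group_axioms_def)
  interpret S: cayley_graph G S by unfold_locales (rule S(2))
  have "finite (letter_image A \<pi>)"
    using assms(2) unfolding alphabet_for_def letter_image_def by simp
  then obtain \<delta>' where "thin_triangles (carrier G) cdist \<delta>'"
    using thin_triangles_change_generators[OF S.cayley_graph_axioms cayley_graph_axioms S(1) _
        S.hyperbolic_imp_thin_triangles[OF S(3)]] by blast
  then show ?thesis
    using FT_BRP_imp_coarse[OF assms(3)] coarse_imp_FT_BRP[OF assms(3)]
      hyperbolic_BRP_iff_coarse[OF assms(3)] by blast
qed

end
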